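(* Each segment of a nonspacelike (timelike or isotropic) nonstrictly abnormal extremal in $(\mathrm{GL}^+(2,\mathbb{C}),d)$ is a longest arc in $(\mathrm{GL}^+(2,\mathbb{C}),d)$, parametrized proportionally to the arclength in the case of a timelike extremal.
   Context: $\mathrm{GL}^+(2,\mathbb{C})$ is the Lie group of complex $2\times2$ matrices with positive real determinant; $\mathfrak{g}=\mathfrak{gl}^+(2,\mathbb{C})$ is its Lie algebra (complex $2\times2$ matrices with real trace). Let $e_0=\frac12 I$, $e_1=\frac12\begin{pmatrix}0&1\\1&0\end{pmatrix}$, $e_2=\frac12\begin{pmatrix}0&\mathbf{i}\\-\mathbf{i}&0\end{pmatrix}$, $e_3=\frac12\begin{pmatrix}1&0\\0&-1\end{pmatrix}$. $H=\mathrm{span}_{\mathbb{R}}(e_0,\dots,e_3)$ is the space of Hermitian matrices, with pseudoscalar product $\langle\cdot,\cdot\rangle$ whose quadratic form is $\langle h,h\rangle=h_0^2-h_1^2-h_2^2-h_3^2=4\det h$ for $h=\sum h_ie_i$. $l_g:h\mapsto gh$. A horizontal curve is a (locally) Lipschitzian curve with $g'(t)=dl_{g(t)}(u(t))$, $u(t)\in H$ for almost all $t$; it is timelike (nonspacelike; isotropic) if for almost all $t$ $\langle u(t),u(t)\rangle>0$ ($\ge0$; $=0$ with $u(t)\ne0$), and future directed if $\langle u(t),e_0\rangle>0$ for almost all $t$. $d(x,y)$ is the supremum of lengths $\int\sqrt{\langle u,u\rangle}\,dt$ of future directed nonspacelike horizontal curves from $x$ to $y$ ($-\infty$ if there are none);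 a longest arc is a future directed nonspacelike horizontal curve realizing this supremum between its endpoints. Timelike extremals: let $U=\{u\in H\mid\langle u,u\rangle\ge1,\ \langle u,e_0\rangle>0\}$. A timelike extremal is a future directed horizontal curve $g(t)$, $t\in\mathbb{R}$, with $\langle u(t),u(t)\rangle=1$ a.e., for which there is an absolutely continuous nowhere vanishing $\psi(t)\in\mathfrak{g}^*$ such that a.e. $\frac{d}{dt}\psi(t)(w)=\psi(t)([u(t),w])$ for all $w\in\mathfrak{g}$ and $\psi(t)(u(t))=\min_{u\in U}\psi(t)(u)=M_0$, $M_0\ge0$ constant; normal with respect to $\psi$ if $M_0>0$, abnormal if $M_0=0$. Isotropic extremals: put $W=\{w\in H\mid\langle w,e_0\rangle=0,\ \langle w,w\rangle=-1\}$. A future directed isotropic horizontal curve is a normal isotropic extremal if, after a proportional change of parameter $t\mapsto\lambda t$, $\lambda>0$, $u(t)=e_0+w(t)$, $w(t)\in W$, and there is an absolutely continuous $\psi(t)\in\mathfrak{g}^*$ with $\psi(t)(e_0)\equiv1$ such that a.e. $\frac{d}{dt}\psi(t)(v)=\psi(t)([u(t),v])$ for all $v\in\mathfrak{g}$ and $\psi(t)(w(t))=\min_{w\in W}\psi(t)(w)=-1$. It is an abnormal isotropic extremal if there is an absolutely continuous nowhere vanishing $\psi(t)\in\mathfrak{g}^*$ with $\psi(t)|_H=0$ and $\frac{d}{dt}\psi(t)(v)=\psi(t)([u(t),v])$ for all $v\in\mathfrak{g}$ and almost all $t$. A (timelike or isotropic) extremal is nonstrictly abnormal if it is abnormal with respect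 to some covector function and normal with respect to some other covector function. *)

theory Defs
  imports "HOL-Analysis.Analysis"
begin

section \<open>The group, its Lie algebra and the space of Hermitian matrices\<close>

type_synonym cmat2 = "complex^2^2"

definition GLplus :: "cmat2 set" where
  "GLplus = {g. det g \<in> \<real> \<and> Re (det g) > 0}"

definition gl :: "cmat2 set" where
  "gl = {w. trace w \<in> \<real>}"

definition e0 :: cmat2 where
  "e0 = (1/2) *\<^sub>R vector [vector [1, 0], vector [0, 1]]"

definition e1 :: cmat2 where
  "e1 = (1/2) *\<^sub>R vector [vector [0, 1], vector [1, 0]]"

definition e2 :: cmat2 where
  "e2 = (1/2) *\<^sub>R vector [vector [0, \<i>], vector [-\<i>, 0]]"

definition e3 :: cmat2 where
  "e3 = (1/2) *\<^sub>R vector [vector [1, 0], vector [0, -1]]"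

definition Herm :: "cmat2 set" where
  "Herm = span {e0, e1, e2, e3}"

text \<open>
  The coordinates of an element of \<^term>\<open>Herm\<close> with respect to the basis \<open>e0, e1, e2, e3\<close>;
  see \<open>coords_combination\<close> below.  They are only meaningful on \<^term>\<open>Herm\<close>.
\<close>

definition co0 :: "cmat2 \<Rightarrow> real" where "co0 h = Re (h $ 1 $ 1 + h $ 2 $ 2)"
definition co1 :: "cmat2 \<Rightarrow> real" where "co1 h = 2 * Re (h $ 1 $ 2)"
definition co2 :: "cmat2 \<Rightarrow> real" where "co2 h = 2 * Im (h $ 1 $ 2)"
definition co3 :: "cmat2 \<Rightarrow> real" where "co3 h = Re (h $ 1 $ 1 - h $ 2 $ 2)"

definition psp :: "cmat2 \<Rightarrow> cmat2 \<Rightarrow> real" where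
  "psp h k = co0 h * co0 k - co1 h * co1 k - co2 h * co2 k - co3 h * co3 k"

definition lie_bracket :: "cmat2 \<Rightarrow> cmat2 \<Rightarrow> cmat2" where
  "lie_bracket v w = v ** w - w ** v"

lemmas basis_defs = e0_def e1_def e2_def e3_def

lemma coords_combination:
  fixes a b c d :: real
  defines "h \<equiv> a *\<^sub>R e0 + b *\<^sub>R e1 + c *\<^sub>R e2 + d *\<^sub>R e3"
  shows "co0 h = a" "co1 h = b" "co2 h = c" "co3 h = d"
  by (simp_all add: h_def basis_defs co0_def co1_def co2_def co3_def field_simps)

lemma mem_Herm_iff: "h \<in> Herm \<longleftrightarrow> (\<exists>a b c d. h = a *\<^sub>R e0 + b *\<^sub>R e1 + c *\<^sub>R e2 + d *\<^sub>R e3)"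
proof
  assume "h \<in> Herm"
  then show "\<exists>a b c d. h = a *\<^sub>R e0 + b *\<^sub>R e1 + c *\<^sub>R e2 + d *\<^sub>R e3"
    unfolding Herm_def span_insert span_empty
    by (auto simp: algebra_simps)
next
  assume "\<exists>a b c d. h = a *\<^sub>R e0 + b *\<^sub>R e1 + c *\<^sub>R e2 + d *\<^sub>R e3"
  then show "h \<in> Herm"
    unfolding Herm_def by (elim exE) (simp add: span_add span_scale span_base)
qed

lemma hermitian_entries:
  assumes "\<forall>i j. h $ i $ j = cnj (h $ j $ i)"
  shows "Im (h $ 1 $ 1) = 0" "Im (h $ 2 $ 2) = 0"
    "Re (h $ 2 $ 1) = Re (h $ 1 $ 2)" "Im (h $ 2 $ 1) = - Im (h $ 1 $ 2)"
  using assms by (metis cnj.simps equal_neg_zero)+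

lemma mem_Herm_iff_hermitian:
  fixes h :: cmat2
  shows "h \<in> Herm \<longleftrightarrow> (\<forall>i j. h $ i $ j = cnj (h $ j $ i))"
proof
  assume "h \<in> Herm"
  then show "\<forall>i j. h $ i $ j = cnj (h $ j $ i)"
    unfolding mem_Herm_iff by (clarsimp simp: basis_defs forall_2 complex_eq_iff)
next
  assume *: "\<forall>i j. h $ i $ j = cnj (h $ j $ i)"
  have "h = co0 h *\<^sub>R e0 + co1 h *\<^sub>R e1 + co2 h *\<^sub>R e2 + co3 h *\<^sub>R e3"
    by (simp add: vec_eq_iff forall_2 basis_defs co0_def co1_def co2_def co3_def complex_eq_iff
        hermitian_entries[OF *] field_simps)
  then show "h \<in> Herm" unfolding mem_Herm_iff by blast
qed

lemma psp_eq_det: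
  assumes "h \<in> Herm"
  shows "psp h h = 4 * Re (det h)"
  using hermitian_entries[OF assms[unfolded mem_Herm_iff_hermitian]]
  by (simp add: psp_def det_2 co0_def co1_def co2_def co3_def algebra_simps)


section \<open>Horizontal curves, length and the sub-Lorentzian distance\<close>

text \<open>
  A horizontal curve \<open>g\<close> on an interval \<open>J\<close> is always considered together with a control \<open>u\<close>;
  \<open>u\<close> is determined by \<open>g\<close> up to a null set and is constrained only almost everywhere.
  Local Lipschitz continuity is stated in matrix coordinates, which is equivalent to local
  Lipschitz continuity for any Riemannian distance on the group.
\<close>

definition horizontal_curve :: "real set \<Rightarrow> (real \<Rightarrow> cmat2) \<Rightarrow> (real \<Rightarrow> cmat2) \<Rightarrow> bool" where
  "horizontal_curve J g u \<longleftrightarrow>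
     g ` J \<subseteq> GLplus \<and>
     (\<forall>a b. {a..b} \<subseteq> J \<longrightarrow> (\<exists>L. L-lipschitz_on {a..b} g)) \<and>
     (AE t in lebesgue. t \<in> J \<longrightarrow>
        u t \<in> Herm \<and> (g has_vector_derivative g t ** u t) (at t within J))"

definition nonspacelike :: "real set \<Rightarrow> (real \<Rightarrow> cmat2) \<Rightarrow> bool" where
  "nonspacelike J u \<longleftrightarrow> (AE t in lebesgue. t \<in> J \<longrightarrow> psp (u t) (u t) \<ge> 0)"

definition isotropic :: "real set \<Rightarrow> (real \<Rightarrow> cmat2) \<Rightarrow> bool" where
  "isotropic J u \<longleftrightarrow> (AE t in lebesgue. t \<in> J \<longrightarrow> psp (u t) (u t) = 0 \<and> u t \<noteq> 0)"

definition future_directed :: "real set \<Rightarrow> (real \<Rightarrow> cmat2) \<Rightarrow> bool" where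
  "future_directed J u \<longleftrightarrow> (AE t in lebesgue. t \<in> J \<longrightarrow> psp (u t) e0 > 0)"

definition causal_curve :: "real set \<Rightarrow> (real \<Rightarrow> cmat2) \<Rightarrow> (real \<Rightarrow> cmat2) \<Rightarrow> bool" where
  "causal_curve J g u \<longleftrightarrow> horizontal_curve J g u \<and> nonspacelike J u \<and> future_directed J u"

definition curve_length :: "real \<Rightarrow> real \<Rightarrow> (real \<Rightarrow> cmat2) \<Rightarrow> real" where
  "curve_length a b u = (LINT t:{a..b}|lebesgue. sqrt (psp (u t) (u t)))"

text \<open>The supremum of the empty set is \<open>-\<infinity>\<close> in \<^typ>\<open>ereal\<close>.\<close>

definition lor_dist :: "cmat2 \<Rightarrow> cmat2 \<Rightarrow> ereal" where
  "lor_dist x y =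
     Sup {ereal (curve_length a b u) | a b g u.
            a < b \<and> causal_curve {a..b} g u \<and> g a = x \<and> g b = y}"

definition longest_arc :: "real \<Rightarrow> real \<Rightarrow> (real \<Rightarrow> cmat2) \<Rightarrow> (real \<Rightarrow> cmat2) \<Rightarrow> bool" where
  "longest_arc a b g u \<longleftrightarrow>
     a < b \<and> causal_curve {a..b} g u \<and> ereal (curve_length a b u) = lor_dist (g a) (g b)"

definition proportional_to_arclength :: "real \<Rightarrow> real \<Rightarrow> (real \<Rightarrow> cmat2) \<Rightarrow> bool" where
  "proportional_to_arclength a b u \<longleftrightarrow>
     (\<exists>c>0. \<forall>s t. a \<le> s \<and> s \<le> t \<and> t \<le> b \<longrightarrow> curve_length s t u = c * (t - s))"


section \<open>Covector functions\<close>

text \<open>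
  A covector is a function on all matrices that is real linear on \<^term>\<open>gl\<close>; its values outside
  \<^term>\<open>gl\<close> are irrelevant.
\<close>

definition gl_dual :: "(cmat2 \<Rightarrow> real) set" where
  "gl_dual = {f. (\<forall>v\<in>gl. \<forall>w\<in>gl. f (v + w) = f v + f w) \<and>
                 (\<forall>c. \<forall>v\<in>gl. f (c *\<^sub>R v) = c * f v)}"

definition abs_continuous_on :: "real \<Rightarrow> real \<Rightarrow> (real \<Rightarrow> real) \<Rightarrow> bool" where
  "abs_continuous_on a b f \<longleftrightarrow>
     (\<forall>\<epsilon>>0. \<exists>\<delta>>0. \<forall>n (x :: nat \<Rightarrow> real) (y :: nat \<Rightarrow> real).
        (\<forall>i<n. a \<le> x i \<and> x i \<le> y i \<and> y i \<le> b) \<and>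
        (\<forall>i<n. \<forall>j<n. i \<noteq> j \<longrightarrow> {x i<..<y i} \<inter> {x j<..<y j} = {}) \<and>
        (\<Sum>i<n. y i - x i) < \<delta>
        \<longrightarrow> (\<Sum>i<n. \<bar>f (y i) - f (x i)\<bar>) < \<epsilon>)"

text \<open>
  Absolute continuity of a curve in the finite-dimensional dual space is tested on every element
  of \<^term>\<open>gl\<close>, and on every compact subinterval of \<open>J\<close>.
\<close>

definition ac_covector :: "real set \<Rightarrow> (real \<Rightarrow> cmat2 \<Rightarrow> real) \<Rightarrow> bool" where
  "ac_covector J \<psi> \<longleftrightarrow>
     (\<forall>t\<in>J. \<psi> t \<in> gl_dual) \<and>
     (\<forall>w\<in>gl. \<forall>a b. {a..b} \<subseteq> J \<longrightarrow> abs_continuous_on a b (\<lambda>t. \<psi> t w))"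

definition nowhere_vanishing :: "real set \<Rightarrow> (real \<Rightarrow> cmat2 \<Rightarrow> real) \<Rightarrow> bool" where
  "nowhere_vanishing J \<psi> \<longleftrightarrow> (\<forall>t\<in>J. \<exists>w\<in>gl. \<psi> t w \<noteq> 0)"

definition adjoint_equation ::
    "real set \<Rightarrow> (real \<Rightarrow> cmat2) \<Rightarrow> (real \<Rightarrow> cmat2 \<Rightarrow> real) \<Rightarrow> bool" where
  "adjoint_equation J u \<psi> \<longleftrightarrow>
     (AE t in lebesgue. t \<in> J \<longrightarrow>
        (\<forall>w\<in>gl. ((\<lambda>s. \<psi> s w) has_real_derivative \<psi> t (lie_bracket (u t) w)) (at t within J)))"


section \<open>Timelike extremals\<close>

definition Uset :: "cmat2 set" where
  "Uset = {u \<in> Herm. psp u u \<ge> 1 \<and> psp u e0 > 0}"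

definition timelike_extremal_wrt ::
    "(real \<Rightarrow> cmat2) \<Rightarrow> (real \<Rightarrow> cmat2) \<Rightarrow> (real \<Rightarrow> cmat2 \<Rightarrow> real) \<Rightarrow> real \<Rightarrow> bool" where
  "timelike_extremal_wrt g u \<psi> M \<longleftrightarrow>
     horizontal_curve UNIV g u \<and> future_directed UNIV u \<and>
     (AE t in lebesgue. psp (u t) (u t) = 1) \<and>
     ac_covector UNIV \<psi> \<and> nowhere_vanishing UNIV \<psi> \<and> adjoint_equation UNIV u \<psi> \<and>
     M \<ge> 0 \<and>
     (AE t in lebesgue. is_arg_min (\<psi> t) (\<lambda>v. v \<in> Uset) (u t) \<and> \<psi> t (u t) = M)"

definition normal_timelike_extremal :: "(real \<Rightarrow> cmat2) \<Rightarrow> (real \<Rightarrow> cmat2) \<Rightarrow> bool" where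
  "normal_timelike_extremal g u \<longleftrightarrow> (\<exists>\<psi> M. M > 0 \<and> timelike_extremal_wrt g u \<psi> M)"

definition abnormal_timelike_extremal :: "(real \<Rightarrow> cmat2) \<Rightarrow> (real \<Rightarrow> cmat2) \<Rightarrow> bool" where
  "abnormal_timelike_extremal g u \<longleftrightarrow> (\<exists>\<psi>. timelike_extremal_wrt g u \<psi> 0)"

definition nonstrictly_abnormal_timelike_extremal ::
    "(real \<Rightarrow> cmat2) \<Rightarrow> (real \<Rightarrow> cmat2) \<Rightarrow> bool" where
  "nonstrictly_abnormal_timelike_extremal g u \<longleftrightarrow>
     abnormal_timelike_extremal g u \<and> normal_timelike_extremal g u"


section \<open>Isotropic extremals\<close>

definition Wset :: "cmat2 set" where
  "Wset = {w \<in> Herm. psp w e0 = 0 \<and> psp w w = -1}"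

definition isotropic_curve :: "real set \<Rightarrow> (real \<Rightarrow> cmat2) \<Rightarrow> (real \<Rightarrow> cmat2) \<Rightarrow> bool" where
  "isotropic_curve J g u \<longleftrightarrow> horizontal_curve J g u \<and> isotropic J u \<and> future_directed J u"

definition normalized_isotropic_covector ::
    "real set \<Rightarrow> (real \<Rightarrow> cmat2) \<Rightarrow> (real \<Rightarrow> cmat2 \<Rightarrow> real) \<Rightarrow> bool" where
  "normalized_isotropic_covector J u \<psi> \<longleftrightarrow>
     ac_covector J \<psi> \<and> (\<forall>t\<in>J. \<psi> t e0 = 1) \<and> adjoint_equation J u \<psi> \<and>
     (AE t in lebesgue. t \<in> J \<longrightarrow>
        is_arg_min (\<psi> t) (\<lambda>w. w \<in> Wset) (u t - e0) \<and> \<psi> t (u t - e0) = -1)"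

text \<open>
  The curve \<open>t \<mapsto> g (c t)\<close> lives on \<open>{t. c t \<in> J}\<close> and has control \<open>t \<mapsto> c u (c t)\<close>.
  That the latter has the form \<open>e0 + w t\<close> with \<open>w t\<close> in \<^term>\<open>Wset\<close> almost everywhere
  is part of the \<^term>\<open>is_arg_min\<close> condition above.
\<close>

definition normal_isotropic_extremal ::
    "real set \<Rightarrow> (real \<Rightarrow> cmat2) \<Rightarrow> (real \<Rightarrow> cmat2) \<Rightarrow> bool" where
  "normal_isotropic_extremal J g u \<longleftrightarrow>
     isotropic_curve J g u \<and>
     (\<exists>c>0. \<exists>\<psi>. normalized_isotropic_covector {t. c * t \<in> J} (\<lambda>t. c *\<^sub>R u (c * t)) \<psi>)"

definition abnormal_isotropic_extremal ::
    "real set \<Rightarrow> (real \<Rightarrow> cmat2) \<Rightarrow> (real \<Rightarrow> cmat2) \<Rightarrow> bool" where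
  "abnormal_isotropic_extremal J g u \<longleftrightarrow>
     isotropic_curve J g u \<and>
     (\<exists>\<psi>. ac_covector J \<psi> \<and> nowhere_vanishing J \<psi> \<and>
          (\<forall>t\<in>J. \<forall>h\<in>Herm. \<psi> t h = 0) \<and> adjoint_equation J u \<psi>)"

definition nonstrictly_abnormal_isotropic_extremal ::
    "real set \<Rightarrow> (real \<Rightarrow> cmat2) \<Rightarrow> (real \<Rightarrow> cmat2) \<Rightarrow> bool" where
  "nonstrictly_abnormal_isotropic_extremal J g u \<longleftrightarrow>
     abnormal_isotropic_extremal J g u \<and> normal_isotropic_extremal J g u"

end

theory Submission
  imports Defs
begin

text \<open>
  A nonstrictly abnormal extremal has a constant control, and every causal curve with constant control
  is longest.

  The first claim combines the two covectors.  The abnormal one vanishes on the Hermitian matrices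
  (in the timelike case because a linear functional with minimum \<open>0\<close> on the solid hyperboloid
  \<^term>\<open>Uset\<close> must vanish), so it amounts to a nonzero linear functional on
  the traceless skew-Hermitian matrices, that is, a vector \<open>q\<close>.  The adjoint equation makes \<open>q\<close>
  constant and the spatial part of the control parallel to it (\<open>abnormal_control_direction\<close>); thus
  the control lies in the span of \<^term>\<open>e0\<close> and a fixed unit vector \<open>n\<close>, which is commutative.
  In the timelike case the normal covector is, on Hermitian matrices, a multiple of the scalar product
  with the control, and its values at \<^term>\<open>e0\<close> and \<open>n\<close> have derivative \<open>0\<close>.  In the isotropic
  case the normalized control is \<open>e0 + n\<close> or \<open>e0 - n\<close>, and the choice is governed by
  the continuous function \<open>t \<mapsto> \<psi> t n\<close> with values \<open>1\<close> and \<open>-1\<close>.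

  For the second claim, write \<open>p\<close> for the coordinate of a Hermitian matrix along \<^term>\<open>e0\<close> and
  \<open>r\<close> for the Euclidean norm of its spatial part, so that \<open>psp u u = p\<^sup>2 - r\<^sup>2\<close>.  Geometrically,
  \<open>g \<mapsto> (ln det g, g g\<^sup>* / det g)\<close> maps the group to the product of a time axis with hyperbolic
  space, and one-parameter subgroups of Hermitian matrices to geodesics.  Their maximality is proved
  by a calibration (\<open>causal_curve_length_le\<close>): for a row vector \<open>z\<close> and a point
  \<open>(\<alpha>, \<beta>)\<close> of the hyperbola \<open>\<alpha>\<^sup>2 - \<beta>\<^sup>2 = 1\<close> the function
  \<open>(\<alpha> + \<beta>) ln det g - \<beta> ln |z g|\<^sup>2\<close> grows along causal curves at least as fast as the length.  If
  \<open>z g(a)\<close> is an eigenvector of the constant control for its larger eigenvalue \<open>(p + r) / 2\<close>, then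
  this function increases by at most \<open>(\<alpha> p - \<beta> r) (b - a)\<close> along the given curve.  The infimum over
  the hyperbola is the length \<open>sqrt (p\<^sup>2 - r\<^sup>2) (b - a)\<close>.  In the isotropic case the infimum is
  \<open>0\<close> and is reached only in the limit \<open>\<alpha> - \<beta> \<rightarrow> 0\<close>.

  All curves are merely Lipschitz and all covectors merely absolutely continuous, so both claims rest
  on the fundamental theorem of calculus for absolutely continuous functions
  (\<open>fundamental_theorem_of_calculus_abs_continuous\<close>).
\<close>

section \<open>Absolutely continuous functions\<close>

text \<open>
  The definition of absolute continuity enumerates its intervals by natural numbers.  In the proof of
  the fundamental theorem below they are indexed by the pieces of a tagged division.
\<close>

lemma abs_continuous_on_finite_family:
  assumes "abs_continuous_on a b f" "0 < e"
  shows "\<exists>\<delta>>0. \<forall>(I :: 'i set) x y. finite I \<longrightarrow> (\<forall>i\<in>I. a \<le> x i \<and> x i \<le> y i \<and> y i \<le> b) \<longrightarrow>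
        disjoint_family_on (\<lambda>i. {x i<..<y i}) I \<longrightarrow> (\<Sum>i\<in>I. y i - x i) < \<delta> \<longrightarrow>
        (\<Sum>i\<in>I. \<bar>f (y i) - f (x i)\<bar>) < e"
proof -
  obtain \<delta> where \<delta>: "0 < \<delta>" and *: "\<forall>n (x :: nat \<Rightarrow> real) (y :: nat \<Rightarrow> real).
        (\<forall>i<n. a \<le> x i \<and> x i \<le> y i \<and> y i \<le> b) \<and>
        (\<forall>i<n. \<forall>j<n. i \<noteq> j \<longrightarrow> {x i<..<y i} \<inter> {x j<..<y j} = {}) \<and>
        (\<Sum>i<n. y i - x i) < \<delta>
        \<longrightarrow> (\<Sum>i<n. \<bar>f (y i) - f (x i)\<bar>) < e"
    using assms(1)[unfolded abs_continuous_on_def, rule_format, OF assms(2)] by (elim exE conjE)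
  show ?thesis
  proof (intro exI[of _ \<delta>] conjI allI impI \<delta>)
    fix I :: "'i set" and x y :: "'i \<Rightarrow> real"
    assume fin: "finite I" and ord: "\<forall>i\<in>I. a \<le> x i \<and> x i \<le> y i \<and> y i \<le> b"
      and disj: "disjoint_family_on (\<lambda>i. {x i<..<y i}) I" and small: "(\<Sum>i\<in>I. y i - x i) < \<delta>"
    obtain h where h: "bij_betw h {..<card I} I"
      using ex_bij_betw_nat_finite[OF fin] by (auto simp: atLeast0LessThan)
    have hI: "h i \<in> I" if "i < card I" for i
      using bij_betwE[OF h] that by auto
    have hne: "h i \<noteq> h j" if "i < card I" "j < card I" "i \<noteq> j" for i j
      using bij_betw_imp_inj_on[OF h] that by (auto simp: inj_on_def)
    have "(\<Sum>i<card I. \<bar>f (y (h i)) - f (x (h i))\<bar>) < e"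
    proof (rule *[rule_format], intro conjI allI impI)
      show "(\<Sum>i<card I. y (h i) - x (h i)) < \<delta>"
        using small sum.reindex_bij_betw[OF h, of "\<lambda>i. y i - x i"] by simp
    next
      fix i j assume "i < card I" "j < card I" "i \<noteq> j"
      then show "{x (h i)<..<y (h i)} \<inter> {x (h j)<..<y (h j)} = {}"
        using disj hI hne unfolding disjoint_family_on_def by simp
    qed (use ord hI in auto)
    then show "(\<Sum>i\<in>I. \<bar>f (y i) - f (x i)\<bar>) < e"
      using sum.reindex_bij_betw[OF h, of "\<lambda>i. \<bar>f (y i) - f (x i)\<bar>"] by simp
  qed
qed

lemma lipschitz_imp_abs_continuous_on:
  assumes "L-lipschitz_on {a..b} f"
  shows "abs_continuous_on a b f"
  unfolding abs_continuous_on_def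
proof (intro allI impI)
  fix e :: real assume e: "0 < e"
  have L: "0 \<le> L" using assms lipschitz_on_nonneg by blast
  show "\<exists>\<delta>>0. \<forall>n (x :: nat \<Rightarrow> real) (y :: nat \<Rightarrow> real).
        (\<forall>i<n. a \<le> x i \<and> x i \<le> y i \<and> y i \<le> b) \<and>
        (\<forall>i<n. \<forall>j<n. i \<noteq> j \<longrightarrow> {x i<..<y i} \<inter> {x j<..<y j} = {}) \<and>
        (\<Sum>i<n. y i - x i) < \<delta>
        \<longrightarrow> (\<Sum>i<n. \<bar>f (y i) - f (x i)\<bar>) < e"
  proof (intro exI[of _ "e / (L + 1)"] conjI allI impI)
    show "0 < e / (L + 1)" using e L by simp
    fix n :: nat and x y :: "nat \<Rightarrow> real"
    assume A: "(\<forall>i<n. a \<le> x i \<and> x i \<le> y i \<and> y i \<le> b) \<and>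
        (\<forall>i<n. \<forall>j<n. i \<noteq> j \<longrightarrow> {x i<..<y i} \<inter> {x j<..<y j} = {}) \<and>
        (\<Sum>i<n. y i - x i) < e / (L + 1)"
    have "(\<Sum>i<n. \<bar>f (y i) - f (x i)\<bar>) \<le> (\<Sum>i<n. (L + 1) * (y i - x i))"
    proof (rule sum_mono)
      fix i assume "i \<in> {..<n}"
      then have i: "a \<le> x i" "x i \<le> y i" "y i \<le> b" using A by auto
      then have "\<bar>f (y i) - f (x i)\<bar> \<le> L * (y i - x i)"
        using lipschitz_onD[OF assms, of "y i" "x i"] by (auto simp: dist_real_def)
      also have "\<dots> \<le> (L + 1) * (y i - x i)" using i by (intro mult_right_mono) auto
      finally show "\<bar>f (y i) - f (x i)\<bar> \<le> (L + 1) * (y i - x i)" .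
    qed
    also have "\<dots> = (L + 1) * (\<Sum>i<n. y i - x i)" by (simp add: sum_distrib_left)
    also have "\<dots> < e" using A L by (simp add: field_simps)
    finally show "(\<Sum>i<n. \<bar>f (y i) - f (x i)\<bar>) < e" .
  qed
qed

lemma total_length_le_emeasure:
  fixes x y :: "'i \<Rightarrow> real"
  assumes "finite I" "\<And>i. i \<in> I \<Longrightarrow> x i \<le> y i" "disjoint_family_on (\<lambda>i. {x i<..<y i}) I"
    and "open S" "\<And>i. i \<in> I \<Longrightarrow> {x i<..<y i} \<subseteq> S"
  shows "ennreal (\<Sum>i\<in>I. y i - x i) \<le> emeasure lborel S"
proof -
  have "ennreal (\<Sum>i\<in>I. y i - x i) = (\<Sum>i\<in>I. emeasure lborel {x i<..<y i})"
    using assms(2) by (subst sum_ennreal[symmetric]) (auto intro!: sum.cong)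
  also have "\<dots> = emeasure lborel (\<Union>i\<in>I. {x i<..<y i})"
    using assms by (intro sum_emeasure) auto
  also have "\<dots> \<le> emeasure lborel S"
    using assms by (intro emeasure_mono) auto
  finally show ?thesis .
qed

text \<open>
  Controls and adjoint equations are only prescribed almost everywhere, so an exceptional null set
  \<open>N\<close> has to be allowed.  Near a tag outside \<open>N\<close> the increment of \<open>f\<close> is approximated by
  the derivative, as in the classical proof.  The pieces tagged in \<open>N\<close> are kept inside an open set
  \<open>S \<supseteq> N\<close> of measure less than \<open>\<delta>\<close>; absolute continuity makes the total increment of \<open>f\<close>
  over them small, and they contribute nothing to the Riemann sum if the integrand is set to
  \<open>0\<close> on \<open>N\<close>.
\<close>

theorem fundamental_theorem_of_calculus_abs_continuous:
  fixes f :: "real \<Rightarrow> real"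
  assumes ab: "a \<le> b" and ac: "abs_continuous_on a b f"
    and ae: "AE t in lebesgue. t \<in> {a..b} \<longrightarrow> (f has_vector_derivative f' t) (at t within {a..b})"
  shows "(f' has_integral (f b - f a)) {a..b}"
proof -
  obtain N where negl: "negligible N"
    and N: "\<And>t. \<lbrakk>t \<in> {a..b}; t \<notin> N\<rbrakk> \<Longrightarrow> (f has_vector_derivative f' t) (at t within {a..b})"
    using ae unfolding eventually_ae_filter_negligible by blast
  define h where "h t = (if t \<in> N then 0 else f' t)" for t
  have "(h has_integral (f b - f a)) {a..b}"
    unfolding has_integral_real
  proof (intro allI impI)
    fix e :: real assume e: "0 < e"
    define \<eta> where "\<eta> = e / (4 * (b - a + 1))"
    have \<eta>: "0 < \<eta>" "\<eta> * (b - a) \<le> e / 4"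
      using e ab by (auto simp: \<eta>_def field_simps)
    have e4: "0 < e / 4" using e by simp
    obtain \<delta> where \<delta>: "0 < \<delta>"
      and small: "\<forall>(I :: (real \<times> real set) set) x y. finite I \<longrightarrow>
          (\<forall>i\<in>I. a \<le> x i \<and> x i \<le> y i \<and> y i \<le> b) \<longrightarrow>
          disjoint_family_on (\<lambda>i. {x i<..<y i}) I \<longrightarrow> (\<Sum>i\<in>I. y i - x i) < \<delta> \<longrightarrow>
          (\<Sum>i\<in>I. \<bar>f (y i) - f (x i)\<bar>) < e / 4"
      using abs_continuous_on_finite_family[OF ac e4] by (elim exE conjE)
    have "N \<in> sets lebesgue" using negl negligible_imp_sets by blast
    then obtain S where S: "open S" "N \<subseteq> S" "emeasure lebesgue (S - N) < ennreal \<delta>"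
      using sets_lebesgue_outer_open[OF _ \<delta>] by metis
    have "emeasure lebesgue S = emeasure lebesgue (S - N)"
      using negl S(1) by (simp add: emeasure_Diff_null_set negligible_iff_null_sets)
    then have emS: "emeasure lborel S < ennreal \<delta>" using S by simp
    have "\<exists>d>0. (t \<in> N \<longrightarrow> ball t d \<subseteq> S) \<and> (t \<in> {a..b} \<and> t \<notin> N \<longrightarrow>
        (\<forall>y\<in>{a..b}. norm (y - t) < d \<longrightarrow> norm (f y - f t - (y - t) *\<^sub>R f' t) \<le> \<eta> * norm (y - t)))" for t
    proof (cases "t \<in> N")
      case True
      then show ?thesis using S open_contains_ball by blast
    next
      case False
      show ?thesis
      proof (cases "t \<in> {a..b}")
        case True
        show ?thesis
          using N[OF True False] \<eta>(1) False
          unfolding has_vector_derivative_def has_derivative_within_alt by blast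
      qed (use False in \<open>auto intro: exI[of _ 1]\<close>)
    qed
    then obtain d where d: "\<And>t. 0 < d t" "\<And>t. t \<in> N \<Longrightarrow> ball t (d t) \<subseteq> S"
      "\<And>t y. \<lbrakk>t \<in> {a..b}; t \<notin> N; y \<in> {a..b}; norm (y - t) < d t\<rbrakk>
        \<Longrightarrow> norm (f y - f t - (y - t) *\<^sub>R f' t) \<le> \<eta> * norm (y - t)"
      by metis
    show "\<exists>\<gamma>. gauge \<gamma> \<and> (\<forall>\<D>. \<D> tagged_division_of {a..b} \<and> \<gamma> fine \<D> \<longrightarrow>
        norm ((\<Sum>(x, k)\<in>\<D>. measure lborel k *\<^sub>R h x) - (f b - f a)) < e)"
    proof (intro exI conjI allI impI)
      show "gauge (\<lambda>t. ball t (d t))" using d(1) gauge_ball_dependent by blast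
    next
      fix p assume p: "p tagged_division_of {a..b} \<and> (\<lambda>t. ball t (d t)) fine p"
      then have tag: "p tagged_division_of {a..b}" and fine: "(\<lambda>t. ball t (d t)) fine p" by auto
      note tagD = tagged_division_ofD[OF tag]
      define lo hi :: "real \<times> real set \<Rightarrow> real" where "lo i = Inf (snd i)" and "hi i = Sup (snd i)" for i
      have piece: "snd i = {lo i..hi i}" "lo i \<le> fst i" "fst i \<le> hi i"
         "a \<le> lo i" "hi i \<le> b" "snd i \<subseteq> ball (fst i) (d (fst i))" if "i \<in> p" for i
      proof -
        obtain t K where i: "i = (t, K)" by force
        have "\<exists>u v. K = {u..v}" using tagD(4)[of t K] that i by simp
        then obtain u v where K: "K = {u..v}" by (elim exE)
        have t: "t \<in> K" "K \<subseteq> {a..b}" using tagD(2)[of t K] tagD(3)[of t K] that i by simp_all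
        have "u \<le> v" using t K by auto
        then show "snd i = {lo i..hi i}" "lo i \<le> fst i" "fst i \<le> hi i"
         "a \<le> lo i" "hi i \<le> b" using t by (auto simp: i K lo_def hi_def)
        show "snd i \<subseteq> ball (fst i) (d (fst i))" using fine that i unfolding fine_def by auto
      qed
      have lo_hi: "lo i \<le> hi i" if "i \<in> p" for i using piece(2,3)[OF that] by linarith
      have disj: "disjoint_family_on (\<lambda>i. {lo i<..<hi i}) p"
        unfolding disjoint_family_on_def
      proof (intro ballI impI)
        fix i j assume ij: "i \<in> p" "j \<in> p" "i \<noteq> j"
        have "interior (snd i) \<inter> interior (snd j) = {}"
          using tagD(5)[of "fst i" "snd i" "fst j" "snd j"] ij by (simp add: prod_eq_iff)
        then show "{lo i<..<hi i} \<inter> {lo j<..<hi j} = {}"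
          by (simp add: piece(1)[OF ij(1)] piece(1)[OF ij(2)])
      qed
      define r where "r i = measure lborel (snd i) *\<^sub>R h (fst i) - (f (hi i) - f (lo i))" for i
      let ?B = "{i \<in> p. fst i \<in> N}" and ?G = "{i \<in> p. fst i \<notin> N}"
      have fin: "finite p" by (rule tagD(1))
      have cont: "measure lborel (snd i) = hi i - lo i" if "i \<in> p" for i
        using content_real[of "lo i" "hi i"] piece(1-3)[OF that] by simp
      have diff: "(\<Sum>(x, k)\<in>p. measure lborel k *\<^sub>R h x) - (f b - f a) = sum r p"
        using additive_tagged_division_1[OF ab tag, of f]
        by (simp add: r_def lo_def hi_def sum_subtractf case_prod_beta)
      have split: "sum r p = sum r ?B + sum r ?G"
        using fin by (subst sum.union_disjoint[symmetric]) (auto intro!: sum.cong)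
      have "norm (sum r ?B) \<le> (\<Sum>i\<in>?B. \<bar>f (hi i) - f (lo i)\<bar>)"
        by (rule sum_norm_le) (auto simp: r_def h_def abs_minus_commute)
      also have "\<dots> < e / 4"
      proof (rule small[rule_format])
        show "finite ?B" using fin by simp
        show djB: "disjoint_family_on (\<lambda>i. {lo i<..<hi i}) ?B"
          using disj unfolding disjoint_family_on_def by auto
        have "ennreal (\<Sum>i\<in>?B. hi i - lo i) \<le> emeasure lborel S"
        proof (rule total_length_le_emeasure[OF _ _ djB S(1)])
          fix i assume i: "i \<in> ?B"
          then have "snd i \<subseteq> S" using piece(6)[of i] d(2)[of "fst i"] by auto
          moreover have "{lo i<..<hi i} \<subseteq> snd i"
            using piece(1)[of i] i by (metis (no_types, lifting) greaterThanLessThan_subseteq_atLeastAtMost_iff mem_Collect_eq order_refl)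
          ultimately show "{lo i<..<hi i} \<subseteq> S" by blast
        qed (use fin lo_hi in auto)
        then have "ennreal (\<Sum>i\<in>?B. hi i - lo i) < ennreal \<delta>" using emS by simp
        then show "(\<Sum>i\<in>?B. hi i - lo i) < \<delta>" using \<delta> ennreal_less_iff
          by (metis (no_types, lifting) ennreal_leI not_le)
        fix i assume "i \<in> ?B"
        then show "a \<le> lo i \<and> lo i \<le> hi i \<and> hi i \<le> b"
          using piece(4,5)[of i] lo_hi[of i] by auto
      qed
      finally have B: "norm (sum r ?B) < e / 4" .
      have "norm (sum r ?G) \<le> (\<Sum>i\<in>?G. \<eta> * measure lborel (snd i))"
      proof (rule sum_norm_le)
        fix i assume i: "i \<in> ?G"
        then have ip: "i \<in> p" and iN: "fst i \<notin> N" by auto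
        define t u v where "t = fst i" and "u = lo i" and "v = hi i"
        have uv: "a \<le> u" "u \<le> t" "t \<le> v" "v \<le> b" "t \<notin> N" "snd i = {u..v}"
          "{u..v} \<subseteq> ball t (d t)"
          using piece[OF ip] iN by (auto simp: t_def u_def v_def)
        have near: "norm (f y - f t - (y - t) *\<^sub>R f' t) \<le> \<eta> * norm (y - t)" if "y \<in> {u..v}" for y
        proof (rule d(3))
          have "y \<in> ball t (d t)" using that uv(7) by blast
          then show "norm (y - t) < d t" by (simp add: dist_real_def)
        qed (use that uv in auto)
        have "norm (r i) = \<bar>(v - u) * f' t - (f v - f u)\<bar>"
          using cont[OF ip] uv(5) by (simp add: r_def h_def t_def u_def v_def)
        also have "\<dots> = \<bar>(f u - f t - (u - t) * f' t) - (f v - f t - (v - t) * f' t)\<bar>"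
          by (simp add: algebra_simps)
        also have "\<dots> \<le> \<eta> * (t - u) + \<eta> * (v - t)"
          using near[of u] near[of v] uv by auto
        also have "\<dots> = \<eta> * measure lborel (snd i)"
          by (simp add: cont[OF ip] u_def v_def algebra_simps)
        finally show "norm (r i) \<le> \<eta> * measure lborel (snd i)" .
      qed
      also have "\<dots> \<le> (\<Sum>i\<in>p. \<eta> * measure lborel (snd i))"
        using fin \<eta> by (intro sum_mono2) auto
      also have "\<dots> = \<eta> * (b - a)"
        using additive_content_tagged_division[of p a b] tag ab
        by (simp add: case_prod_beta flip: sum_distrib_left)
      finally have G: "norm (sum r ?G) \<le> e / 4" using \<eta>(2) by linarith
      show "norm ((\<Sum>(x, k)\<in>p. measure lborel k *\<^sub>R h x) - (f b - f a)) < e"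
        unfolding diff split using norm_triangle_ineq[of "sum r ?B" "sum r ?G"] B G e by linarith
    qed
  qed
  then show ?thesis
    by (rule has_integral_spike[OF negl, rotated]) (auto simp: h_def)
qed

section \<open>Calculus with Lipschitz functions\<close>

lemma (in bounded_bilinear) lipschitz_on_prod_compact:
  assumes f: "L-lipschitz_on S f" and g: "M-lipschitz_on S g" and S: "compact S"
  shows "\<exists>K. K-lipschitz_on S (\<lambda>x. prod (f x) (g x))"
proof -
  have "bounded (f ` S)" "bounded (g ` S)"
    using S f g by (auto intro!: compact_imp_bounded compact_continuous_image
        lipschitz_on_continuous_on)
  then obtain A B where A: "0 < A" "\<And>x. x \<in> S \<Longrightarrow> norm (f x) \<le> A"
    and B: "0 < B" "\<And>x. x \<in> S \<Longrightarrow> norm (g x) \<le> B"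
    unfolding bounded_pos by auto
  obtain K where K: "0 < K" "\<And>a b. norm (prod a b) \<le> norm a * norm b * K"
    using pos_bounded by blast
  have LM: "0 \<le> L" "0 \<le> M" using f g lipschitz_on_nonneg by blast+
  have "(L * B * K + A * M * K)-lipschitz_on S (\<lambda>x. prod (f x) (g x))"
  proof (rule lipschitz_onI)
    fix x y assume xy: "x \<in> S" "y \<in> S"
    have "prod (f x) (g x) - prod (f y) (g y) = prod (f x - f y) (g x) + prod (f y) (g x - g y)"
      by (simp add: diff_left diff_right)
    then have "dist (prod (f x) (g x)) (prod (f y) (g y))
        \<le> norm (prod (f x - f y) (g x)) + norm (prod (f y) (g x - g y))"
      by (simp add: dist_norm norm_triangle_ineq)
    also have "\<dots> \<le> norm (f x - f y) * norm (g x) * K + norm (f y) * norm (g x - g y) * K"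
      by (intro add_mono K)
    also have "\<dots> \<le> (L * dist x y) * B * K + A * (M * dist x y) * K"
      using A B K LM xy lipschitz_onD[OF f xy] lipschitz_onD[OF g xy]
      by (intro add_mono mult_mono) (auto simp: dist_norm)
    finally show "dist (prod (f x) (g x)) (prod (f y) (g y)) \<le> (L * B * K + A * M * K) * dist x y"
      by (simp add: algebra_simps)
  qed (use A B K LM in auto)
  then show ?thesis ..
qed

lemma (in bounded_linear) lipschitz_on_image:
  assumes "L-lipschitz_on S g"
  shows "\<exists>K. K-lipschitz_on S (\<lambda>x. f (g x))"
  using lipschitz_boundE lipschitz_on_compose2[OF assms] by metis

lemma lipschitz_on_ln_compact:
  fixes f :: "'a::metric_space \<Rightarrow> real"
  assumes f: "L-lipschitz_on S f" and S: "compact S" and pos: "\<And>x. x \<in> S \<Longrightarrow> 0 < f x"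
  shows "\<exists>K. K-lipschitz_on S (\<lambda>x. ln (f x))"
proof (cases "S = {}")
  case False
  obtain x0 where x0: "x0 \<in> S" "\<And>x. x \<in> S \<Longrightarrow> f x0 \<le> f x"
    using continuous_attains_inf[OF S False lipschitz_on_continuous_on[OF f]] by blast
  have m: "0 < f x0" using x0 pos by blast
  have L: "0 \<le> L" using f lipschitz_on_nonneg by blast
  have le: "ln (f x) - ln (f y) \<le> L / f x0 * dist x y" if "x \<in> S" "y \<in> S" for x y
  proof -
    have "ln (f x) - ln (f y) \<le> (f x - f y) / f y"
      using ln_diff_le[of "f x" "f y"] pos that by simp
    also have "\<dots> \<le> \<bar>f x - f y\<bar> / f x0"
      using x0(2)[OF that(2)] m pos[OF that(2)] by (intro frac_le) auto
    also have "\<dots> \<le> L * dist x y / f x0"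
      using lipschitz_onD[OF f that] m by (intro divide_right_mono) (auto simp: dist_real_def)
    finally show ?thesis by simp
  qed
  have "(L / f x0)-lipschitz_on S (\<lambda>x. ln (f x))"
  proof (rule lipschitz_onI)
    fix x y assume "x \<in> S" "y \<in> S"
    then show "dist (ln (f x)) (ln (f y)) \<le> L / f x0 * dist x y"
      using le[of x y] le[of y x] by (auto simp: dist_real_def dist_commute abs_le_iff)
  qed (use L m in auto)
  then show ?thesis ..
qed (auto intro: exI[of _ 0])

lemma log_derivative_has_integral:
  fixes f :: "real \<Rightarrow> real"
  assumes "a \<le> b" and f: "L-lipschitz_on {a..b} f" and pos: "\<And>t. t \<in> {a..b} \<Longrightarrow> 0 < f t"
    and ae: "AE t in lebesgue. t \<in> {a..b} \<longrightarrow> (f has_vector_derivative f' t) (at t within {a..b})"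
  shows "((\<lambda>t. f' t / f t) has_integral ln (f b) - ln (f a)) {a..b}"
proof -
  obtain K where K: "K-lipschitz_on {a..b} (\<lambda>t. ln (f t))"
    using lipschitz_on_ln_compact[OF f _ pos] by auto
  show ?thesis
  proof (rule fundamental_theorem_of_calculus_abs_continuous[OF assms(1) lipschitz_imp_abs_continuous_on[OF K]])
    show "AE t in lebesgue. t \<in> {a..b} \<longrightarrow>
      ((\<lambda>t. ln (f t)) has_vector_derivative f' t / f t) (at t within {a..b})"
      using ae
    proof eventually_elim
      case (elim t)
      then show ?case
        using pos[of t]
        by (auto simp flip: has_real_derivative_iff_has_vector_derivative
            intro!: derivative_eq_intros)
    qed
  qed
qed

lemma exponential_growth:
  fixes f :: "real \<Rightarrow> real"
  assumes "a \<le> b" and f: "L-lipschitz_on {a..b} f"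
    and ae: "AE t in lebesgue. t \<in> {a..b} \<longrightarrow> (f has_vector_derivative c * f t) (at t within {a..b})"
  shows "f b = f a * exp (c * (b - a))"
proof -
  let ?C = "\<bar>c\<bar> * exp (\<bar>c\<bar> * (\<bar>a\<bar> + \<bar>b\<bar>))"
  have "?C-lipschitz_on {a..b} (\<lambda>t. exp (- (c * t)))"
  proof (rule bounded_derivative_imp_lipschitz)
    fix t assume t: "t \<in> {a..b}"
    show "((\<lambda>t. exp (- (c * t))) has_derivative (\<lambda>h. - c * exp (- (c * t)) * h)) (at t within {a..b})"
      by (auto intro!: derivative_eq_intros)
    have "- (c * t) \<le> \<bar>c\<bar> * \<bar>t\<bar>" by (metis abs_ge_minus_self abs_mult)
    also have "\<dots> \<le> \<bar>c\<bar> * (\<bar>a\<bar> + \<bar>b\<bar>)" using t by (intro mult_left_mono) auto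
    finally show "onorm (\<lambda>h. - c * exp (- (c * t)) * h) \<le> ?C"
      by (intro onorm_le) (auto simp: abs_mult intro!: mult_right_mono mult_left_mono)
  qed auto
  from bounded_bilinear.lipschitz_on_prod_compact[OF bounded_bilinear_mult this f]
  obtain K where K: "K-lipschitz_on {a..b} (\<lambda>t. exp (- (c * t)) * f t)"
    by auto
  have "((\<lambda>t. 0) has_integral exp (- (c * b)) * f b - exp (- (c * a)) * f a) {a..b}"
  proof (rule fundamental_theorem_of_calculus_abs_continuous[OF assms(1) lipschitz_imp_abs_continuous_on[OF K]])
    show "AE t in lebesgue. t \<in> {a..b} \<longrightarrow>
      ((\<lambda>t. exp (- (c * t)) * f t) has_vector_derivative 0) (at t within {a..b})"
      using ae
    proof eventually_elim
      case (elim t)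
      then show ?case
        by (auto simp flip: has_real_derivative_iff_has_vector_derivative
            intro!: derivative_eq_intros)
    qed
  qed
  then have "exp (- (c * b)) * f b = exp (- (c * a)) * f a"
    using has_integral_unique[OF _ has_integral_0] by fastforce
  then show ?thesis
    by (simp add: exp_minus exp_diff right_diff_distrib field_simps)
qed

text \<open>
  The length of a curve is a Lebesgue integral, and the calibration bounds its integrand by a gauge
  integrable function.  If the Lebesgue integral does not exist, then its value is \<open>0\<close> by convention,
  which is still at most \<open>I\<close>, because the majorant is nonnegative; so the measurability of the
  integrand is never at issue.
\<close>

lemma set_lebesgue_integral_le_has_integral:
  fixes f :: "real \<Rightarrow> real"
  assumes h: "(h has_integral I) S"
    and le: "AE t in lebesgue. t \<in> S \<longrightarrow> 0 \<le> f t \<and> f t \<le> h t"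
  shows "(LINT t:S|lebesgue. f t) \<le> I"
proof -
  obtain N where N: "negligible N" and fh: "\<And>t. \<lbrakk>t \<in> S; t \<notin> N\<rbrakk> \<Longrightarrow> 0 \<le> f t \<and> f t \<le> h t"
    using le unfolding eventually_ae_filter_negligible by blast
  have bound: "J \<le> I" if "(k has_integral J) S" "\<And>t. \<lbrakk>t \<in> S; t \<notin> N\<rbrakk> \<Longrightarrow> k t \<le> h t" for k J
  proof (rule has_integral_le[OF _ h])
    show "((\<lambda>t. if t \<in> N then h t else k t) has_integral J) S"
      by (rule has_integral_spike[OF N _ that(1)]) auto
  qed (use that in auto)
  show ?thesis
  proof (cases "set_integrable lebesgue S f")
    case True
    then show ?thesis using bound[OF has_integral_set_lebesgue] fh by blast
  next
    case False
    then have "(LINT t:S|lebesgue. f t) = 0"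
      by (simp add: set_lebesgue_integral_def set_integrable_def not_integrable_integral_eq)
    moreover have "0 \<le> I" using bound[OF has_integral_0] fh by fastforce
    ultimately show ?thesis by simp
  qed
qed

section \<open>Hermitian matrices as Minkowski space\<close>

text \<open>
  The Euclidean norm of the part of a Hermitian matrix orthogonal to \<^term>\<open>e0\<close>.  The eigenvalues
  of a Hermitian matrix \<open>h\<close> are \<open>(co0 h \<plusminus> spatial_norm h) / 2\<close>.
\<close>

definition spatial_norm :: "cmat2 \<Rightarrow> real" where
  "spatial_norm h = sqrt ((co1 h)\<^sup>2 + (co2 h)\<^sup>2 + (co3 h)\<^sup>2)"

lemma spatial_norm_nonneg: "0 \<le> spatial_norm h"
  by (simp add: spatial_norm_def)

lemma psp_self: "psp h h = (co0 h)\<^sup>2 - (spatial_norm h)\<^sup>2"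
  by (simp add: psp_def spatial_norm_def power2_eq_square)

lemma psp_e0: "psp h e0 = co0 h"
  by (simp add: psp_def e0_def co0_def co1_def co2_def co3_def)

lemma causal_spatial_norm_le:
  assumes "0 \<le> psp h h" "0 < psp h e0"
  shows "spatial_norm h \<le> co0 h"
  using assms unfolding psp_self psp_e0 by (auto intro: power2_le_imp_le[of "spatial_norm h" "co0 h"])

lemma Herm_entries:
  assumes "h \<in> Herm"
  shows "h $ 1 $ 1 = Complex ((co0 h + co3 h) / 2) 0" "h $ 2 $ 2 = Complex ((co0 h - co3 h) / 2) 0"
    "h $ 1 $ 2 = Complex (co1 h / 2) (co2 h / 2)" "h $ 2 $ 1 = Complex (co1 h / 2) (- co2 h / 2)"
  using hermitian_entries[OF assms[unfolded mem_Herm_iff_hermitian]]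
  by (auto simp: complex_eq_iff co0_def co1_def co2_def co3_def)

lemma inner_row_Herm:
  fixes x y :: "complex^2"
  assumes "h \<in> Herm"
  shows "(x v* h) \<bullet> y = x \<bullet> (y v* h)"
  unfolding vector_matrix_mult_def inner_vec_def
  by (simp add: sum_2 Herm_entries[OF assms] inner_complex_def algebra_simps)

text \<open>
  This is the bound of the quadratic form of \<open>h\<close> by its larger eigenvalue.  The vector
  \<open>(X1, X2, X3)\<close> in the proof is the image of the row \<open>x\<close> under the Hopf map, whose length is
  \<open>x \<bullet> x\<close>; the quadratic form is \<open>co0 h * (x \<bullet> x)\<close> plus the scalar product of the spatial part
  of \<open>h\<close> with this vector, and the Cauchy-Schwarz inequality applies.
\<close>

lemma inner_row_Herm_le:
  fixes x :: "complex^2"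
  assumes h: "h \<in> Herm"
  shows "2 * ((x v* h) \<bullet> x) \<le> (co0 h + spatial_norm h) * (x \<bullet> x)"
proof -
  obtain a b c d where x: "x $ 1 = Complex a b" "x $ 2 = Complex c d"
    by (metis complex_surj)
  define X1 X2 X3 where "X1 = 2 * (a * c + b * d)" and "X2 = 2 * (a * d - b * c)"
    and "X3 = a\<^sup>2 + b\<^sup>2 - c\<^sup>2 - d\<^sup>2"
  have N: "x \<bullet> x = a\<^sup>2 + b\<^sup>2 + c\<^sup>2 + d\<^sup>2"
    by (simp add: inner_vec_def sum_2 x inner_complex_def power2_eq_square)
  have eq: "2 * ((x v* h) \<bullet> x) = co0 h * (x \<bullet> x) + (co1 h * X1 + co2 h * X2 + co3 h * X3)"
    unfolding N X1_def X2_def X3_def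
    by (simp add: vector_matrix_mult_def inner_vec_def sum_2 Herm_entries[OF h] x inner_complex_def
        power2_eq_square field_simps)
  have "(co1 h * X1 + co2 h * X2 + co3 h * X3)\<^sup>2
      \<le> ((co1 h)\<^sup>2 + (co2 h)\<^sup>2 + (co3 h)\<^sup>2) * (X1\<^sup>2 + X2\<^sup>2 + X3\<^sup>2)"
  proof -
    have eq: "((co1 h)\<^sup>2 + (co2 h)\<^sup>2 + (co3 h)\<^sup>2) * (X1\<^sup>2 + X2\<^sup>2 + X3\<^sup>2)
        = (co1 h * X1 + co2 h * X2 + co3 h * X3)\<^sup>2 + ((co1 h * X2 - co2 h * X1)\<^sup>2
          + (co1 h * X3 - co3 h * X1)\<^sup>2 + (co2 h * X3 - co3 h * X2)\<^sup>2)"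
      by algebra
    show ?thesis unfolding eq by simp
  qed
  also have "X1\<^sup>2 + X2\<^sup>2 + X3\<^sup>2 = (x \<bullet> x)\<^sup>2"
    unfolding N X1_def X2_def X3_def by algebra
  also have "((co1 h)\<^sup>2 + (co2 h)\<^sup>2 + (co3 h)\<^sup>2) = (spatial_norm h)\<^sup>2"
    by (simp add: spatial_norm_def)
  finally have "(co1 h * X1 + co2 h * X2 + co3 h * X3)\<^sup>2 \<le> (spatial_norm h * (x \<bullet> x))\<^sup>2"
    by (simp add: power_mult_distrib)
  then have "co1 h * X1 + co2 h * X2 + co3 h * X3 \<le> spatial_norm h * (x \<bullet> x)"
    by (rule power2_le_imp_le) (simp add: spatial_norm_nonneg)
  then show ?thesis using eq by (simp add: algebra_simps)
qed

text \<open>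
  The eigenvector \<open>(r + co3 h, co1 h + \<i> co2 h)\<close>, with \<open>r\<close> the spatial norm, degenerates only if
  the spatial part of \<open>h\<close> is a nonpositive multiple of \<^term>\<open>e3\<close>; then \<open>h\<close> is diagonal with
  the larger eigenvalue in the second place.
\<close>

lemma Herm_max_eigenrow:
  assumes h: "h \<in> Herm"
  obtains y :: "complex^2" where "y \<noteq> 0" "y v* h = ((co0 h + spatial_norm h) / 2) *\<^sub>R y"
proof (cases "spatial_norm h + co3 h = 0")
  case False
  define r where "r = spatial_norm h"
  have r: "r\<^sup>2 = (co1 h)\<^sup>2 + (co2 h)\<^sup>2 + (co3 h)\<^sup>2" by (simp add: r_def spatial_norm_def)
  have r': "co1 h * co1 h + co2 h * co2 h = r * r - co3 h * co3 h"
    using r by (simp add: power2_eq_square)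
  define y :: "complex^2" where "y = vector [Complex (r + co3 h) 0, Complex (co1 h) (co2 h)]"
  show thesis
  proof
    show "y \<noteq> 0" using False by (auto simp: y_def vec_eq_iff complex_eq_iff r_def forall_2)
    show "y v* h = ((co0 h + spatial_norm h) / 2) *\<^sub>R y"
      using r' by (simp add: vec_eq_iff forall_2 vector_matrix_mult_def sum_2 Herm_entries[OF h]
          y_def complex_eq_iff flip: r_def) (simp add: field_simps)
  qed
next
  case True
  have r: "(co3 h)\<^sup>2 = (co1 h)\<^sup>2 + (co2 h)\<^sup>2 + (co3 h)\<^sup>2"
    using True by (smt (verit) power2_minus real_sqrt_pow2 spatial_norm_def zero_le_power2)
  then have z: "co1 h = 0" "co2 h = 0"
    by (smt (verit) zero_le_power2 power2_eq_iff zero_power2 power_eq_0_iff)+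
  define y :: "complex^2" where "y = vector [0, 1]"
  show thesis
  proof
    show "y \<noteq> 0" by (auto simp: y_def vec_eq_iff forall_2)
    show "y v* h = ((co0 h + spatial_norm h) / 2) *\<^sub>R y"
      using True by (simp add: vec_eq_iff forall_2 vector_matrix_mult_def sum_2 Herm_entries[OF h]
          y_def complex_eq_iff z)
  qed
qed

section \<open>Determinant and rows along a horizontal curve\<close>

lemma bounded_linear_row: "bounded_linear (\<lambda>g :: cmat2. z v* g)"
  unfolding linear_conv_bounded_linear[symmetric]
  by (rule linearI) (simp_all add: vec_eq_iff forall_2 vector_matrix_mult_def sum_2 algebra_simps)

lemma bounded_linear_entry: "bounded_linear (\<lambda>g :: cmat2. g $ i $ j)"
  by (rule bounded_linear_compose[OF bounded_linear_vec_nth bounded_linear_vec_nth])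

lemma lipschitz_on_det:
  fixes g :: "real \<Rightarrow> cmat2"
  assumes g: "L-lipschitz_on {a..b} g"
  shows "\<exists>K. K-lipschitz_on {a..b} (\<lambda>t. Re (det (g t)))"
proof -
  have mult: "\<exists>K. K-lipschitz_on {a..b} (\<lambda>t. g t $ i $ j * g t $ k $ l)" for i j k l
  proof -
    obtain K1 where K1: "K1-lipschitz_on {a..b} (\<lambda>t. g t $ i $ j)"
      using bounded_linear.lipschitz_on_image[OF bounded_linear_entry g] by blast
    obtain K2 where K2: "K2-lipschitz_on {a..b} (\<lambda>t. g t $ k $ l)"
      using bounded_linear.lipschitz_on_image[OF bounded_linear_entry g] by blast
    show ?thesis
      by (rule bounded_bilinear.lipschitz_on_prod_compact[OF bounded_bilinear_mult K1 K2 compact_Icc])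
  qed
  obtain K1 where K1: "K1-lipschitz_on {a..b} (\<lambda>t. g t $ 1 $ 1 * g t $ 2 $ 2)"
    using mult by blast
  obtain K2 where K2: "K2-lipschitz_on {a..b} (\<lambda>t. g t $ 1 $ 2 * g t $ 2 $ 1)"
    using mult by blast
  have "(K1 + K2)-lipschitz_on {a..b} (\<lambda>t. det (g t))"
    unfolding det_2 by (rule lipschitz_on_diff[OF K1 K2])
  then show ?thesis by (rule bounded_linear.lipschitz_on_image[OF bounded_linear_Re])
qed

lemma det_has_vector_derivative:
  assumes "(g has_vector_derivative g t ** u) (at t within S)" "u \<in> Herm" "det (g t) \<in> \<real>"
  shows "((\<lambda>t. Re (det (g t))) has_vector_derivative Re (det (g t)) * co0 u) (at t within S)"
proof -
  have entry: "((\<lambda>s. g s $ i $ j) has_vector_derivative (g t ** u) $ i $ j) (at t within S)" for i j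
    using bounded_linear.has_vector_derivative[OF bounded_linear_entry assms(1)] .
  have "((\<lambda>t. det (g t)) has_vector_derivative det (g t) * (u $ 1 $ 1 + u $ 2 $ 2)) (at t within S)"
    unfolding det_2
    using has_vector_derivative_diff[OF
        has_vector_derivative_mult[OF entry[of 1 1] entry[of 2 2]]
        has_vector_derivative_mult[OF entry[of 1 2] entry[of 2 1]]]
    by (rule has_vector_derivative_eq_rhs) (simp add: matrix_matrix_mult_def sum_2 algebra_simps)
  from bounded_linear.has_vector_derivative[OF bounded_linear_Re this]
  show ?thesis
    using assms(3) by (simp add: Herm_entries[OF assms(2)] complex_is_Real_iff field_simps)
qed

lemma row_has_vector_derivative:
  fixes g :: "real \<Rightarrow> cmat2"
  assumes "(g has_vector_derivative g t ** u) (at t within S)"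
  shows "((\<lambda>t. z v* g t) has_vector_derivative (z v* g t) v* u) (at t within S)"
  using bounded_linear.has_vector_derivative[OF bounded_linear_row assms]
  by (simp add: vector_matrix_mul_assoc)

lemma row_GLplus_nonzero:
  fixes z :: "complex^2"
  assumes "g \<in> GLplus" "z \<noteq> 0"
  shows "z v* g \<noteq> 0"
proof
  assume "z v* g = 0"
  have "det g \<noteq> 0" using assms by (auto simp: GLplus_def)
  then obtain g' where "g ** g' = mat 1"
    using invertible_det_nz[of g] unfolding invertible_def by blast
  then have "(z v* g) v* g' = z" by (simp add: vector_matrix_mul_assoc)
  then show False using assms(2) \<open>z v* g = 0\<close> by simp
qed

context
  fixes a b :: real and g u :: "real \<Rightarrow> cmat2"
  assumes ab: "a \<le> b" and hc: "horizontal_curve {a..b} g u"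
begin

lemma horizontal_curve_lipschitz: "\<exists>L. L-lipschitz_on {a..b} g"
  using hc unfolding horizontal_curve_def by blast

lemma horizontal_curve_ae:
  "AE t in lebesgue. t \<in> {a..b} \<longrightarrow>
     u t \<in> Herm \<and> (g has_vector_derivative g t ** u t) (at t within {a..b})"
  using hc unfolding horizontal_curve_def by blast

lemma horizontal_curve_GLplus: "t \<in> {a..b} \<Longrightarrow> g t \<in> GLplus"
  using hc unfolding horizontal_curve_def by blast

lemma ln_det_horizontal:
  "((\<lambda>t. co0 (u t)) has_integral ln (Re (det (g b))) - ln (Re (det (g a)))) {a..b}"
proof -
  obtain K where K: "K-lipschitz_on {a..b} (\<lambda>t. Re (det (g t)))"
    using horizontal_curve_lipschitz lipschitz_on_det by blast
  have pos: "0 < Re (det (g t))" if "t \<in> {a..b}" for t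
    using horizontal_curve_GLplus[OF that] by (simp add: GLplus_def)
  have "((\<lambda>t. Re (det (g t)) * co0 (u t) / Re (det (g t))) has_integral
      ln (Re (det (g b))) - ln (Re (det (g a)))) {a..b}"
  proof (rule log_derivative_has_integral[OF ab K pos])
    show "AE t in lebesgue. t \<in> {a..b} \<longrightarrow>
      ((\<lambda>t. Re (det (g t))) has_vector_derivative Re (det (g t)) * co0 (u t)) (at t within {a..b})"
      using horizontal_curve_ae
    proof eventually_elim
      case (elim t)
      then show ?case
        using det_has_vector_derivative horizontal_curve_GLplus by (auto simp: GLplus_def)
    qed
  qed
  then show ?thesis
    by (rule has_integral_eq[rotated]) (use pos in fastforce)
qed

text \<open>
  The squared length of the row \<open>z v* g\<close> is the value at \<open>z\<close> of the Hermitian form of the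
  positive definite matrix \<open>g g\<^sup>*\<close>.  Divided by the determinant it is the exponential of a Busemann
  function of hyperbolic space, which is why its logarithm detects geodesics.
\<close>

lemma ln_row_horizontal:
  fixes z :: "complex^2"
  assumes z: "z \<noteq> 0"
  defines "\<rho> \<equiv> \<lambda>t. z v* g t"
  shows "((\<lambda>t. 2 * ((\<rho> t v* u t) \<bullet> \<rho> t) / (\<rho> t \<bullet> \<rho> t)) has_integral
     ln (\<rho> b \<bullet> \<rho> b) - ln (\<rho> a \<bullet> \<rho> a)) {a..b}"
proof -
  obtain Lg where Lg: "Lg-lipschitz_on {a..b} g"
    using horizontal_curve_lipschitz by blast
  obtain L where L: "L-lipschitz_on {a..b} \<rho>"
    using bounded_linear.lipschitz_on_image[OF bounded_linear_row Lg] unfolding \<rho>_def by blast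
  obtain K where K: "K-lipschitz_on {a..b} (\<lambda>t. \<rho> t \<bullet> \<rho> t)"
    using bounded_bilinear.lipschitz_on_prod_compact[OF bounded_bilinear_inner L L compact_Icc] by blast
  have pos: "0 < \<rho> t \<bullet> \<rho> t" if "t \<in> {a..b}" for t
    using row_GLplus_nonzero[OF horizontal_curve_GLplus[OF that] z] by (simp add: \<rho>_def)
  show ?thesis
  proof (rule log_derivative_has_integral[OF ab K pos])
    show "AE t in lebesgue. t \<in> {a..b} \<longrightarrow>
      ((\<lambda>t. \<rho> t \<bullet> \<rho> t) has_vector_derivative 2 * ((\<rho> t v* u t) \<bullet> \<rho> t)) (at t within {a..b})"
      using horizontal_curve_ae
    proof eventually_elim
      case (elim t)
      show ?case
      proof
        assume "t \<in> {a..b}"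
        then have "(\<rho> has_vector_derivative \<rho> t v* u t) (at t within {a..b})"
          using elim row_has_vector_derivative unfolding \<rho>_def by blast
        from bounded_bilinear.has_vector_derivative[OF bounded_bilinear_inner this this]
        show "((\<lambda>t. \<rho> t \<bullet> \<rho> t) has_vector_derivative 2 * ((\<rho> t v* u t) \<bullet> \<rho> t)) (at t within {a..b})"
          by (simp add: inner_commute)
      qed
    qed
  qed
qed

end

section \<open>The calibration inequality\<close>

text \<open>
  The left-hand side is the Minkowski length of a causal vector \<open>(p, r)\<close>, the right-hand side is
  its product with the unit timelike vector \<open>(\<alpha>, \<beta>)\<close>.
\<close>

lemma reverse_cauchy_schwarz:
  fixes \<alpha> \<beta> p r :: real
  assumes "\<alpha>\<^sup>2 - \<beta>\<^sup>2 = 1" "0 \<le> \<beta>" "0 < \<alpha>" "0 \<le> r" "r \<le> p"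
  shows "sqrt (p\<^sup>2 - r\<^sup>2) \<le> \<alpha> * p - \<beta> * r"
proof (rule real_le_lsqrt)
  have "\<beta>\<^sup>2 \<le> \<alpha>\<^sup>2" using assms(1) by linarith
  then have "\<beta> \<le> \<alpha>" by (rule power2_le_imp_le) (use assms(3) in linarith)
  then show "0 \<le> \<alpha> * p - \<beta> * r" using assms mult_mono[of \<beta> \<alpha> r p] by simp
  have eq: "(\<alpha> * p - \<beta> * r)\<^sup>2 = p\<^sup>2 - r\<^sup>2 + (\<alpha> * r - \<beta> * p)\<^sup>2"
    using assms(1) by algebra
  show "p\<^sup>2 - r\<^sup>2 \<le> (\<alpha> * p - \<beta> * r)\<^sup>2" unfolding eq by simp
qed

text \<open>
  The function \<open>(\<alpha> + \<beta>) ln det g - \<beta> ln |z v* g|\<^sup>2\<close> grows along every causal curve at least as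
  fast as the length: the logarithm of the determinant has derivative \<open>co0 u\<close>, the logarithm of the
  squared row has derivative at most \<open>co0 u + spatial_norm u\<close>, and hence the function has derivative
  at least \<open>\<alpha> * co0 u - \<beta> * spatial_norm u\<close>, which bounds the length element by the reverse
  Cauchy-Schwarz inequality.  Its total increment depends only on the endpoints.
\<close>

lemma causal_curve_length_le:
  fixes z :: "complex^2"
  assumes "a \<le> b" and cc: "causal_curve {a..b} g u" and z: "z \<noteq> 0"
    and hyp: "\<alpha>\<^sup>2 - \<beta>\<^sup>2 = 1" "0 \<le> \<beta>" "0 < \<alpha>"
  shows "curve_length a b u \<le> (\<alpha> + \<beta>) * (ln (Re (det (g b))) - ln (Re (det (g a))))
     - \<beta> * (ln ((z v* g b) \<bullet> (z v* g b)) - ln ((z v* g a) \<bullet> (z v* g a)))"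
proof -
  have hc: "horizontal_curve {a..b} g u" using cc by (simp add: causal_curve_def)
  define \<rho> where "\<rho> t = z v* g t" for t
  show ?thesis
    unfolding curve_length_def
  proof (rule set_lebesgue_integral_le_has_integral)
    show "((\<lambda>t. (\<alpha> + \<beta>) * co0 (u t) - \<beta> * (2 * ((\<rho> t v* u t) \<bullet> \<rho> t) / (\<rho> t \<bullet> \<rho> t))) has_integral
      (\<alpha> + \<beta>) * (ln (Re (det (g b))) - ln (Re (det (g a))))
     - \<beta> * (ln ((z v* g b) \<bullet> (z v* g b)) - ln ((z v* g a) \<bullet> (z v* g a)))) {a..b}"
      unfolding \<rho>_def
      by (intro has_integral_diff has_integral_mult_right ln_det_horizontal ln_row_horizontal assms hc)
    have "AE t in lebesgue. t \<in> {a..b} \<longrightarrow> 0 \<le> psp (u t) (u t)"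
      and "AE t in lebesgue. t \<in> {a..b} \<longrightarrow> 0 < psp (u t) e0"
      using cc unfolding causal_curve_def nonspacelike_def future_directed_def by blast+
    with horizontal_curve_ae[OF assms(1) hc]
    show "AE t in lebesgue. t \<in> {a..b} \<longrightarrow> 0 \<le> sqrt (psp (u t) (u t)) \<and> sqrt (psp (u t) (u t))
        \<le> (\<alpha> + \<beta>) * co0 (u t) - \<beta> * (2 * ((\<rho> t v* u t) \<bullet> \<rho> t) / (\<rho> t \<bullet> \<rho> t))"
    proof eventually_elim
      case (elim t)
      show ?case
      proof
        assume t: "t \<in> {a..b}"
        let ?p = "co0 (u t)" and ?r = "spatial_norm (u t)"
        have pos: "0 < \<rho> t \<bullet> \<rho> t"
          using row_GLplus_nonzero[OF horizontal_curve_GLplus[OF assms(1) hc t] z] by (simp add: \<rho>_def)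
        have "2 * ((\<rho> t v* u t) \<bullet> \<rho> t) / (\<rho> t \<bullet> \<rho> t) \<le> ?p + ?r"
          using inner_row_Herm_le[of "u t" "\<rho> t"] elim t pos by (simp add: pos_divide_le_eq)
        from mult_left_mono[OF this hyp(2)]
        have "\<alpha> * ?p - \<beta> * ?r
          \<le> (\<alpha> + \<beta>) * ?p - \<beta> * (2 * ((\<rho> t v* u t) \<bullet> \<rho> t) / (\<rho> t \<bullet> \<rho> t))"
          by (simp add: algebra_simps)
        moreover have "sqrt (psp (u t) (u t)) \<le> \<alpha> * ?p - \<beta> * ?r"
          unfolding psp_self using elim t
          by (intro reverse_cauchy_schwarz hyp causal_spatial_norm_le spatial_norm_nonneg) auto
        ultimately show "0 \<le> sqrt (psp (u t) (u t)) \<and> sqrt (psp (u t) (u t))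
          \<le> (\<alpha> + \<beta>) * co0 (u t) - \<beta> * (2 * ((\<rho> t v* u t) \<bullet> \<rho> t) / (\<rho> t \<bullet> \<rho> t))"
          using elim t by simp
      qed
    qed
  qed
qed

section \<open>Constant controls give longest arcs\<close>

lemma curve_length_constant_speed:
  assumes "s \<le> t" and ae: "AE x in lebesgue. x \<in> {s..t} \<longrightarrow> psp (u x) (u x) = k"
  shows "curve_length s t u = sqrt k * (t - s)"
proof -
  obtain N where N: "negligible N" "\<And>x. \<lbrakk>x \<in> {s..t}; x \<notin> N\<rbrakk> \<Longrightarrow> psp (u x) (u x) = k"
    using ae unfolding eventually_ae_filter_negligible by blast
  have "set_integrable lebesgue {s..t} (\<lambda>x. sqrt (psp (u x) (u x)))"
    by (rule absolutely_integrable_spike[OF absolutely_integrable_on_const[of "{s..t}" "sqrt k"] N(1)])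
      (use N(2) in auto)
  then have "curve_length s t u = integral {s..t} (\<lambda>x. sqrt (psp (u x) (u x)))"
    unfolding curve_length_def by (rule set_lebesgue_integral_eq_integral)
  also have "\<dots> = integral {s..t} (\<lambda>x. sqrt k)"
    by (rule integral_spike[OF N(1)]) (use N(2) in auto)
  also have "\<dots> = sqrt k * (t - s)" using assms(1) by simp
  finally show ?thesis .
qed

text \<open>
  For \<open>r < p\<close> the optimal unit vector is parallel to \<open>(p, r)\<close>.  For lightlike \<open>(p, r)\<close> the
  infimum \<open>0\<close> is not attained; it is approached along \<open>\<alpha> + \<beta> = 1 / \<epsilon>\<close>, \<open>\<alpha> - \<beta> = \<epsilon>\<close>.
\<close>

lemma le_of_hyperbolic_bounds:
  fixes p r l T :: real
  assumes "0 < p" "0 \<le> r" "r \<le> p" "0 < T"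
    and bound: "\<And>\<alpha> \<beta>. \<lbrakk>\<alpha>\<^sup>2 - \<beta>\<^sup>2 = 1; 0 \<le> \<beta>; 0 < \<alpha>\<rbrakk> \<Longrightarrow> l \<le> (\<alpha> * p - \<beta> * r) * T"
  shows "l \<le> sqrt (p\<^sup>2 - r\<^sup>2) * T"
proof (cases "r < p")
  case True
  define s where "s = sqrt (p\<^sup>2 - r\<^sup>2)"
  have lt: "r\<^sup>2 < p\<^sup>2" using True assms by (intro power_strict_mono) auto
  then have s: "0 < s" and s2: "s\<^sup>2 = p\<^sup>2 - r\<^sup>2" by (auto simp: s_def)
  have "(p / s)\<^sup>2 - (r / s)\<^sup>2 = 1"
    unfolding power_divide diff_divide_distrib[symmetric] s2[symmetric] using s by simp
  then have "l \<le> (p / s * p - r / s * r) * T" by (rule bound) (use s assms in auto)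
  also have "p / s * p - r / s * r = s\<^sup>2 / s" unfolding s2 by (simp add: power2_eq_square diff_divide_distrib)
  also have "\<dots> = s" using s by (simp add: power2_eq_square)
  finally show ?thesis by (simp add: s_def)
next
  case False
  then have r: "r = p" using assms by simp
  have eps: "l \<le> \<epsilon> * (p * T)" if "0 < \<epsilon>" "\<epsilon> \<le> 1" for \<epsilon>
  proof -
    have "\<epsilon> \<le> 1 / \<epsilon>" using that mult_mono[of \<epsilon> 1 \<epsilon> 1] by (simp add: field_simps)
    moreover have "((1 / \<epsilon> + \<epsilon>) / 2)\<^sup>2 - ((1 / \<epsilon> - \<epsilon>) / 2)\<^sup>2 = 1"
      using that by (simp add: power2_eq_square field_simps)
    ultimately have "l \<le> ((1 / \<epsilon> + \<epsilon>) / 2 * p - (1 / \<epsilon> - \<epsilon>) / 2 * r) * T"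
      using that by (intro bound) (auto simp: add_pos_pos)
    then show ?thesis by (simp add: r field_simps)
  qed
  have "l \<le> 0"
  proof (rule ccontr)
    assume "\<not> l \<le> 0"
    moreover have pT: "0 < p * T" using assms by simp
    ultimately have "min 1 (l / (2 * (p * T))) * (p * T) < l"
      by (auto simp: min_def field_simps)
    then show False using eps[of "min 1 (l / (2 * (p * T)))"] \<open>\<not> l \<le> 0\<close> pT by simp
  qed
  then show ?thesis by (simp add: r)
qed

lemma constant_control_det_growth:
  assumes "a \<le> b" and hc: "horizontal_curve {a..b} g u"
    and ae: "AE t in lebesgue. t \<in> {a..b} \<longrightarrow> u t = v"
  shows "ln (Re (det (g b))) - ln (Re (det (g a))) = co0 v * (b - a)"
proof -
  obtain N where N: "negligible N" "\<And>t. \<lbrakk>t \<in> {a..b}; t \<notin> N\<rbrakk> \<Longrightarrow> u t = v"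
    using ae unfolding eventually_ae_filter_negligible by blast
  have "((\<lambda>t. co0 v) has_integral co0 v * (b - a)) {a..b}"
    using has_integral_const_real[of "co0 v" a b] assms(1) by (simp add: mult.commute)
  then have "((\<lambda>t. co0 (u t)) has_integral co0 v * (b - a)) {a..b}"
    by (rule has_integral_spike[OF N(1), rotated]) (use N(2) in auto)
  then show ?thesis using ln_det_horizontal[OF assms(1) hc] has_integral_unique by blast
qed

text \<open>
  If the row at the initial point is an eigenvector \<open>y\<close> of the constant control, then its component
  along \<open>y\<close> satisfies a scalar linear equation with constant coefficient and grows exactly
  exponentially.  The component bounds the length of the row from below.
\<close>

lemma constant_control_row_growth:
  fixes y z :: "complex^2"
  assumes "a \<le> b" and hc: "horizontal_curve {a..b} g u"
    and ae: "AE t in lebesgue. t \<in> {a..b} \<longrightarrow> u t = v" and v: "v \<in> Herm"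
    and y: "y \<noteq> 0" "y v* v = c *\<^sub>R y" and z: "z v* g a = y"
  shows "2 * c * (b - a) \<le> ln ((z v* g b) \<bullet> (z v* g b)) - ln ((z v* g a) \<bullet> (z v* g a))"
proof -
  define \<sigma> where "\<sigma> t = (z v* g t) \<bullet> y" for t
  obtain Lg where Lg: "Lg-lipschitz_on {a..b} g"
    using horizontal_curve_lipschitz[OF assms(1) hc] by blast
  obtain L where L: "L-lipschitz_on {a..b} \<sigma>"
    using bounded_linear.lipschitz_on_image[OF
        bounded_linear_compose[OF bounded_linear_inner_left bounded_linear_row] Lg]
    unfolding \<sigma>_def by blast
  have "\<sigma> b = \<sigma> a * exp (c * (b - a))"
  proof (rule exponential_growth[OF assms(1) L])
    show "AE t in lebesgue. t \<in> {a..b} \<longrightarrow> (\<sigma> has_vector_derivative c * \<sigma> t) (at t within {a..b})"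
      using horizontal_curve_ae[OF assms(1) hc] ae
    proof eventually_elim
      case (elim t)
      show ?case
      proof
        assume t: "t \<in> {a..b}"
        then have "((\<lambda>t. z v* g t) has_vector_derivative (z v* g t) v* v) (at t within {a..b})"
          using elim row_has_vector_derivative by blast
        from bounded_linear.has_vector_derivative[OF bounded_linear_inner_left[of y] this]
        show "(\<sigma> has_vector_derivative c * \<sigma> t) (at t within {a..b})"
          unfolding \<sigma>_def by (simp add: inner_row_Herm[OF v] y(2))
      qed
    qed
  qed
  then have \<sigma>b: "\<sigma> b = (y \<bullet> y) * exp (c * (b - a))" by (simp add: \<sigma>_def z)
  have yy: "0 < y \<bullet> y" using y by simp
  have "(\<sigma> b)\<^sup>2 \<le> ((z v* g b) \<bullet> (z v* g b)) * (y \<bullet> y)"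
    unfolding \<sigma>_def by (rule Cauchy_Schwarz_ineq)
  then have "(y \<bullet> y) * ((y \<bullet> y) * exp (2 * c * (b - a))) \<le> (y \<bullet> y) * ((z v* g b) \<bullet> (z v* g b))"
    unfolding \<sigma>b
    by (simp add: power2_eq_square exp_add[symmetric] algebra_simps flip: mult_2)
  then have le: "(y \<bullet> y) * exp (2 * c * (b - a)) \<le> (z v* g b) \<bullet> (z v* g b)"
    using yy by simp
  have "ln (y \<bullet> y) + 2 * c * (b - a) = ln ((y \<bullet> y) * exp (2 * c * (b - a)))"
    using yy by (simp add: ln_mult)
  also have "\<dots> \<le> ln ((z v* g b) \<bullet> (z v* g b))"
    using le yy by (intro ln_mono) (auto intro: less_le_trans mult_pos_pos)
  finally show ?thesis by (simp add: z)
qed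

text \<open>
  The row \<open>z\<close> of the calibration is chosen so that \<open>z v* g a\<close> is an eigenvector for the larger
  eigenvalue of the control.  The increment of the calibration between the endpoints of the curve is
  then at most \<open>(\<alpha> * co0 v - \<beta> * spatial_norm v) * (b - a)\<close>, and the infimum of this bound over
  \<open>\<alpha>\<close> and \<open>\<beta>\<close> is the length of the curve.
\<close>

theorem constant_control_longest_arc:
  assumes ab: "a < b" and cc: "causal_curve {a..b} g u"
    and ae: "AE t in lebesgue. t \<in> {a..b} \<longrightarrow> u t = v"
    and v: "v \<in> Herm" "0 \<le> psp v v" "0 < psp v e0"
  shows "longest_arc a b g u"
proof -
  let ?p = "co0 v" and ?r = "spatial_norm v"
  have hc: "horizontal_curve {a..b} g u" using cc by (simp add: causal_curve_def)
  have len: "curve_length a b u = sqrt (psp v v) * (b - a)"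
    by (rule curve_length_constant_speed) (use ab ae in \<open>auto elim: eventually_mono\<close>)
  obtain y :: "complex^2" where y: "y \<noteq> 0" "y v* v = ((?p + ?r) / 2) *\<^sub>R y"
    using Herm_max_eigenrow[OF v(1)] by blast
  have "det (g a) \<noteq> 0" using horizontal_curve_GLplus[OF _ hc, of a] ab by (auto simp: GLplus_def)
  then obtain g' where g': "g' ** g a = mat 1"
    using invertible_det_nz[of "g a"] unfolding invertible_def by blast
  define z where "z = y v* g'"
  have z: "z v* g a = y" by (simp add: z_def vector_matrix_mul_assoc g')
  then have z0: "z \<noteq> 0" using y by auto
  have det: "ln (Re (det (g b))) - ln (Re (det (g a))) = ?p * (b - a)"
    using constant_control_det_growth[OF _ hc ae] ab by simp
  have row: "(?p + ?r) * (b - a) \<le> ln ((z v* g b) \<bullet> (z v* g b)) - ln ((z v* g a) \<bullet> (z v* g a))"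
    using constant_control_row_growth[OF less_imp_le[OF ab] hc ae v(1) y z]
    unfolding nonzero_mult_div_cancel_left[OF zero_neq_numeral[symmetric]] times_divide_eq_right .
  have le: "curve_length a' b' u' \<le> sqrt (psp v v) * (b - a)"
    if "a' < b'" "causal_curve {a'..b'} g' u'" "g' a' = g a" "g' b' = g b" for a' b' g' u'
    unfolding psp_self
  proof (rule le_of_hyperbolic_bounds)
    fix \<alpha> \<beta> :: real assume h: "\<alpha>\<^sup>2 - \<beta>\<^sup>2 = 1" "0 \<le> \<beta>" "0 < \<alpha>"
    have "curve_length a' b' u' \<le> (\<alpha> + \<beta>) * (?p * (b - a))
      - \<beta> * (ln ((z v* g b) \<bullet> (z v* g b)) - ln ((z v* g a) \<bullet> (z v* g a)))"
      using causal_curve_length_le[OF _ that(2) z0 h] that det by simp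
    also have "\<dots> \<le> (\<alpha> + \<beta>) * (?p * (b - a)) - \<beta> * ((?p + ?r) * (b - a))"
      using mult_left_mono[OF row h(2)] by simp
    also have "\<dots> = (\<alpha> * ?p - \<beta> * ?r) * (b - a)" by (simp add: algebra_simps)
    finally show "curve_length a' b' u' \<le> (\<alpha> * ?p - \<beta> * ?r) * (b - a)" .
  qed (use v ab causal_spatial_norm_le in \<open>auto simp: psp_e0 spatial_norm_nonneg\<close>)
  have "ereal (curve_length a b u) = lor_dist (g a) (g b)"
    unfolding lor_dist_def
  proof (rule antisym)
    show "ereal (curve_length a b u) \<le> Sup {ereal (curve_length a' b' u') | a' b' g' u'.
      a' < b' \<and> causal_curve {a'..b'} g' u' \<and> g' a' = g a \<and> g' b' = g b}"
      using ab cc by (intro Sup_upper) blast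
    show "Sup {ereal (curve_length a' b' u') | a' b' g' u'.
      a' < b' \<and> causal_curve {a'..b'} g' u' \<and> g' a' = g a \<and> g' b' = g b} \<le> ereal (curve_length a b u)"
      using le unfolding len by (intro Sup_least) auto
  qed
  then show ?thesis using ab cc by (simp add: longest_arc_def)
qed

section \<open>Consequences of absolute continuity and of almost everywhere statements\<close>

lemma abs_continuous_on_subinterval:
  assumes "abs_continuous_on a b f" "a \<le> c" "d \<le> b"
  shows "abs_continuous_on c d f"
  unfolding abs_continuous_on_def
proof (intro allI impI)
  fix e :: real assume "0 < e"
  then obtain \<delta> where \<delta>: "0 < \<delta>" and *: "\<forall>n (x :: nat \<Rightarrow> real) (y :: nat \<Rightarrow> real).
        (\<forall>i<n. a \<le> x i \<and> x i \<le> y i \<and> y i \<le> b) \<and>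
        (\<forall>i<n. \<forall>j<n. i \<noteq> j \<longrightarrow> {x i<..<y i} \<inter> {x j<..<y j} = {}) \<and>
        (\<Sum>i<n. y i - x i) < \<delta>
        \<longrightarrow> (\<Sum>i<n. \<bar>f (y i) - f (x i)\<bar>) < e"
    using assms(1) unfolding abs_continuous_on_def by (elim allE[of _ e] impE exE conjE) auto
  show "\<exists>\<delta>>0. \<forall>n (x :: nat \<Rightarrow> real) (y :: nat \<Rightarrow> real).
        (\<forall>i<n. c \<le> x i \<and> x i \<le> y i \<and> y i \<le> d) \<and>
        (\<forall>i<n. \<forall>j<n. i \<noteq> j \<longrightarrow> {x i<..<y i} \<inter> {x j<..<y j} = {}) \<and>
        (\<Sum>i<n. y i - x i) < \<delta>
        \<longrightarrow> (\<Sum>i<n. \<bar>f (y i) - f (x i)\<bar>) < e"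
  proof (intro exI[of _ \<delta>] conjI allI impI \<delta>)
    fix n :: nat and x y :: "nat \<Rightarrow> real"
    assume A: "(\<forall>i<n. c \<le> x i \<and> x i \<le> y i \<and> y i \<le> d) \<and>
        (\<forall>i<n. \<forall>j<n. i \<noteq> j \<longrightarrow> {x i<..<y i} \<inter> {x j<..<y j} = {}) \<and> (\<Sum>i<n. y i - x i) < \<delta>"
    have "\<forall>i<n. a \<le> x i \<and> x i \<le> y i \<and> y i \<le> b" using A assms(2,3) by (meson order_trans)
    then show "(\<Sum>i<n. \<bar>f (y i) - f (x i)\<bar>) < e" using * A by blast
  qed
qed

lemma abs_continuous_on_imp_continuous_on:
  assumes "abs_continuous_on a b f"
  shows "continuous_on {a..b} f"
  unfolding continuous_on_iff
proof (intro ballI allI impI)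
  fix s e :: real assume s: "s \<in> {a..b}" and e: "0 < e"
  obtain \<delta> where \<delta>: "0 < \<delta>" and *: "\<forall>n (x :: nat \<Rightarrow> real) (y :: nat \<Rightarrow> real).
        (\<forall>i<n. a \<le> x i \<and> x i \<le> y i \<and> y i \<le> b) \<and>
        (\<forall>i<n. \<forall>j<n. i \<noteq> j \<longrightarrow> {x i<..<y i} \<inter> {x j<..<y j} = {}) \<and>
        (\<Sum>i<n. y i - x i) < \<delta>
        \<longrightarrow> (\<Sum>i<n. \<bar>f (y i) - f (x i)\<bar>) < e"
    using assms e unfolding abs_continuous_on_def by (elim allE[of _ e] impE exE conjE) auto
  show "\<exists>d>0. \<forall>t\<in>{a..b}. dist t s < d \<longrightarrow> dist (f t) (f s) < e"
  proof (intro exI[of _ \<delta>] conjI ballI impI \<delta>)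
    fix t assume t: "t \<in> {a..b}" "dist t s < \<delta>"
    have "(\<Sum>i<(1::nat). \<bar>f (max s t) - f (min s t)\<bar>) < e"
      by (rule *[rule_format, of 1 "\<lambda>_. min s t" "\<lambda>_. max s t"])
        (use s t in \<open>auto simp: dist_real_def min_def max_def abs_if split: if_splits\<close>)
    then show "dist (f t) (f s) < e"
      by (auto simp: dist_real_def min_def max_def abs_minus_commute split: if_splits)
  qed
qed

lemma abs_continuous_zero_derivative_constant:
  fixes f :: "real \<Rightarrow> real"
  assumes ac: "abs_continuous_on a b f"
    and ae: "AE t in lebesgue. t \<in> {a..b} \<longrightarrow> (f has_real_derivative 0) (at t within {a..b})"
    and t: "t \<in> {a..b}"
  shows "f t = f a"
proof -
  have "((\<lambda>_. 0) has_integral f t - f a) {a..t}"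
  proof (rule fundamental_theorem_of_calculus_abs_continuous)
    show "abs_continuous_on a t f" using ac t by (auto intro: abs_continuous_on_subinterval)
    show "AE s in lebesgue. s \<in> {a..t} \<longrightarrow> (f has_vector_derivative 0) (at s within {a..t})"
      using ae
    proof eventually_elim
      case (elim s)
      then show ?case
        using t by (auto simp flip: has_real_derivative_iff_has_vector_derivative
            intro: has_field_derivative_subset)
    qed
  qed (use t in auto)
  then show ?thesis using has_integral_unique[OF _ has_integral_0] by fastforce
qed

lemma continuous_closed_AE_imp_all:
  fixes f :: "real \<Rightarrow> real"
  assumes "a < b" "continuous_on {a..b} f" "closed C"
    and ae: "AE t in lebesgue. t \<in> {a..b} \<longrightarrow> f t \<in> C"
    and t: "t \<in> {a..b}"
  shows "f t \<in> C"
proof -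
  let ?D = "{a..b} \<inter> f -` C"
  have D: "closed ?D" by (rule continuous_closed_preimage) (use assms in auto)
  have "{a<..<b} \<subseteq> ?D"
  proof
    fix s assume "s \<in> {a<..<b}"
    then show "s \<in> ?D"
      by (rule mem_closed_if_AE_lebesgue_open[OF open_greaterThanLessThan D, rotated])
        (use ae in \<open>auto elim: eventually_mono\<close>)
  qed
  then have "closure {a<..<b} \<subseteq> ?D" using D by (rule closure_minimal)
  then show ?thesis using closure_greaterThanLessThan[OF assms(1)] t by auto
qed

lemma AE_interval_obtain:
  assumes "a < b" "AE t in lebesgue. t \<in> {a..b::real} \<longrightarrow> P t"
  obtains t where "t \<in> {a..b}" "P t"
proof -
  obtain N where N: "negligible N" "\<And>t. \<lbrakk>t \<in> {a..b}; t \<notin> N\<rbrakk> \<Longrightarrow> P t"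
    using assms(2) unfolding eventually_ae_filter_negligible by blast
  have "\<not> negligible {a..b}" using assms(1) negligible_interval(1)[of a b] by simp
  then have "\<not> {a..b} \<subseteq> N" using N(1) negligible_subset by blast
  then show thesis using that N(2) by blast
qed

lemma AE_lebesgue_scale:
  fixes c :: real
  assumes "c \<noteq> 0" "AE t in lebesgue. P t"
  shows "AE t in lebesgue. P (t / c)"
proof -
  obtain N where N: "negligible N" "{t. \<not> P t} \<subseteq> N"
    using assms(2) unfolding eventually_ae_filter_negligible by blast
  have "negligible ((\<lambda>t. c * t) ` N)"
    by (rule negligible_differentiable_image_negligible[OF order_refl N(1)]) (auto intro!: derivative_intros)
  moreover have "{t. \<not> P (t / c)} \<subseteq> (\<lambda>t. c * t) ` N"
  proof
    fix t assume "t \<in> {t. \<not> P (t / c)}"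
    then have "t / c \<in> N" using N(2) by auto
    then show "t \<in> (\<lambda>t. c * t) ` N" using assms(1) by (intro image_eqI[of _ _ "t / c"]) auto
  qed
  ultimately show ?thesis unfolding eventually_ae_filter_negligible by blast
qed

section \<open>The Lie algebra and its dual\<close>

lemma coords_linear:
  "co0 (v + w) = co0 v + co0 w" "co1 (v + w) = co1 v + co1 w"
  "co2 (v + w) = co2 v + co2 w" "co3 (v + w) = co3 v + co3 w"
  "co0 (v - w) = co0 v - co0 w" "co1 (v - w) = co1 v - co1 w"
  "co2 (v - w) = co2 v - co2 w" "co3 (v - w) = co3 v - co3 w"
  "co0 (c *\<^sub>R v) = c * co0 v" "co1 (c *\<^sub>R v) = c * co1 v"
  "co2 (c *\<^sub>R v) = c * co2 v" "co3 (c *\<^sub>R v) = c * co3 v"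
  by (simp_all add: co0_def co1_def co2_def co3_def algebra_simps)

lemma coords_basis:
  "co0 e0 = 1" "co1 e0 = 0" "co2 e0 = 0" "co3 e0 = 0"
  "co0 e1 = 0" "co1 e1 = 1" "co2 e1 = 0" "co3 e1 = 0"
  "co0 e2 = 0" "co1 e2 = 0" "co2 e2 = 1" "co3 e2 = 0"
  "co0 e3 = 0" "co1 e3 = 0" "co2 e3 = 0" "co3 e3 = 1"
  by (simp_all add: co0_def co1_def co2_def co3_def basis_defs)

lemma Herm_basis: "e0 \<in> Herm" "e1 \<in> Herm" "e2 \<in> Herm" "e3 \<in> Herm"
  unfolding Herm_def by (auto intro: span_base)

lemma Herm_linear:
  "v \<in> Herm \<Longrightarrow> w \<in> Herm \<Longrightarrow> v + w \<in> Herm" "v \<in> Herm \<Longrightarrow> w \<in> Herm \<Longrightarrow> v - w \<in> Herm"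
  "v \<in> Herm \<Longrightarrow> c *\<^sub>R v \<in> Herm"
  unfolding Herm_def by (auto intro: span_add span_diff span_scale)

lemma Herm_expand:
  assumes "h \<in> Herm"
  shows "h = co0 h *\<^sub>R e0 + co1 h *\<^sub>R e1 + co2 h *\<^sub>R e2 + co3 h *\<^sub>R e3"
  by (simp add: vec_eq_iff forall_2 Herm_entries[OF assms] basis_defs complex_eq_iff field_simps)

lemma gl_linear: "v \<in> gl \<Longrightarrow> w \<in> gl \<Longrightarrow> v + w \<in> gl" "v \<in> gl \<Longrightarrow> c *\<^sub>R v \<in> gl"
  by (auto simp: gl_def complex_is_Real_iff trace_def sum_2 simp flip: distrib_left)

lemma Herm_subset_gl: "h \<in> Herm \<Longrightarrow> h \<in> gl"
  by (auto simp: gl_def complex_is_Real_iff trace_def sum_2 Herm_entries)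

lemma lie_bracket_in_gl: "lie_bracket v w \<in> gl"
  by (simp add: gl_def lie_bracket_def trace_def sum_2 matrix_matrix_mult_def)

lemma gl_dual_linear:
  assumes "f \<in> gl_dual" "v \<in> gl"
  shows "w \<in> gl \<Longrightarrow> f (v + w) = f v + f w" "f (c *\<^sub>R v) = c * f v"
  using assms by (auto simp: gl_dual_def)

lemma gl_dual_zero: "f \<in> gl_dual \<Longrightarrow> f 0 = 0"
  using gl_dual_linear(2)[of f e0 0] by (simp add: Herm_basis Herm_subset_gl)

text \<open>
  The matrices \<open>- \<i> e1\<close>, \<open>- \<i> e2\<close>, \<open>- \<i> e3\<close>, a basis of the skew-Hermitian traceless matrices.
  Together with \<open>e0, \<dots>, e3\<close> they form a basis of \<^term>\<open>gl\<close>, and their brackets with Hermitian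
  matrices are Hermitian.
\<close>

definition rot1 :: cmat2 where "rot1 = lie_bracket e2 e3"
definition rot2 :: cmat2 where "rot2 = lie_bracket e3 e1"
definition rot3 :: cmat2 where "rot3 = lie_bracket e1 e2"

lemmas rot_defs = rot1_def rot2_def rot3_def

lemma rot_in_gl: "rot1 \<in> gl" "rot2 \<in> gl" "rot3 \<in> gl"
  by (simp_all add: rot_defs lie_bracket_in_gl)

lemma lie_bracket_Herm:
  assumes "h \<in> Herm"
  shows "lie_bracket h e0 = 0"
    "lie_bracket h e1 = co3 h *\<^sub>R rot2 + (- co2 h) *\<^sub>R rot3"
    "lie_bracket h e2 = co1 h *\<^sub>R rot3 + (- co3 h) *\<^sub>R rot1"
    "lie_bracket h e3 = co2 h *\<^sub>R rot1 + (- co1 h) *\<^sub>R rot2"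
  by (simp_all add: rot_defs lie_bracket_def vec_eq_iff forall_2 matrix_matrix_mult_def sum_2
      Herm_entries[OF assms] basis_defs complex_eq_iff field_simps)

lemma lie_bracket_rot:
  assumes "h \<in> Herm"
  shows "lie_bracket h rot1 \<in> Herm" "lie_bracket h rot2 \<in> Herm" "lie_bracket h rot3 \<in> Herm"
  by (simp_all add: mem_Herm_iff_hermitian rot_defs lie_bracket_def forall_2
      matrix_matrix_mult_def sum_2 Herm_entries[OF assms] basis_defs complex_eq_iff field_simps)

lemma gl_decompose:
  assumes "w \<in> gl"
  shows "\<exists>h\<in>Herm. \<exists>a b c. w = h + (a *\<^sub>R rot1 + (b *\<^sub>R rot2 + c *\<^sub>R rot3))"
proof -
  have tr: "Im (w $ 1 $ 1) + Im (w $ 2 $ 2) = 0"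
    using assms by (simp add: gl_def trace_def sum_2 complex_is_Real_iff)
  define a b c where "a = - (Im (w $ 1 $ 2) + Im (w $ 2 $ 1))"
    and "b = Re (w $ 1 $ 2) - Re (w $ 2 $ 1)" and "c = Im (w $ 2 $ 2) - Im (w $ 1 $ 1)"
  have "w - (a *\<^sub>R rot1 + (b *\<^sub>R rot2 + c *\<^sub>R rot3)) \<in> Herm"
    using tr by (simp add: mem_Herm_iff_hermitian rot_defs lie_bracket_def forall_2
      matrix_matrix_mult_def sum_2 basis_defs complex_eq_iff a_def b_def c_def field_simps)
  then show ?thesis by (metis diff_add_cancel)
qed

lemma gl_dual_eq_zero:
  assumes f: "f \<in> gl_dual" and "\<And>h. h \<in> Herm \<Longrightarrow> f h = 0" "f rot1 = 0" "f rot2 = 0" "f rot3 = 0"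
    and "w \<in> gl"
  shows "f w = 0"
proof -
  obtain h a b c where "h \<in> Herm" "w = h + (a *\<^sub>R rot1 + (b *\<^sub>R rot2 + c *\<^sub>R rot3))"
    using gl_decompose[OF assms(6)] by blast
  then show ?thesis
    using assms by (simp add: gl_dual_linear[OF f] gl_linear rot_in_gl Herm_subset_gl)
qed

lemma psp_add_left: "psp (v + w) h = psp v h + psp w h"
  and psp_scaleR_left: "psp (c *\<^sub>R v) h = c * psp v h"
  and psp_diff_right: "psp h (v - w) = psp h v - psp h w"
  and psp_scaleR_right: "psp h (c *\<^sub>R v) = c * psp h v"
  and psp_commute: "psp v h = psp h v"
  by (simp_all add: psp_def coords_linear algebra_simps)

section \<open>The minimum condition for timelike controls\<close>

text \<open>
  The hyperboloid \<open>psp w w = 1\<close> is tangent to \<open>h\<close> at \<open>v\<close>.  The correction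
  \<open>K * \<epsilon>\<^sup>2\<close> of second order keeps \<open>v + \<epsilon> h\<close> in \<^term>\<open>Uset\<close>, so \<open>f h < 0\<close> would decrease
  \<open>f\<close> to first order.
\<close>

lemma minimum_on_Uset_nonneg:
  assumes f: "f \<in> gl_dual" and v: "v \<in> Herm" "psp v v = 1" "0 < psp v e0"
    and min: "\<And>w. w \<in> Uset \<Longrightarrow> f v \<le> f w"
    and h: "h \<in> Herm" "psp v h = 0"
  shows "0 \<le> f h"
proof (rule ccontr)
  assume "\<not> 0 \<le> f h"
  then have neg: "f h < 0" by simp
  define K where "K = \<bar>psp h h\<bar>"
  define A where "A = K * \<bar>f v\<bar> + 1"
  define \<epsilon> where "\<epsilon> = min (co0 v / (2 * (\<bar>co0 h\<bar> + 1))) (- f h / (2 * A))"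
  have pos0: "0 < co0 v" using v by (simp add: psp_e0)
  have K: "0 \<le> K" and A: "0 < A" by (simp_all add: K_def A_def add_nonneg_pos)
  have "0 < co0 v / (2 * (\<bar>co0 h\<bar> + 1))" "0 < - f h / (2 * A)"
    using neg pos0 A by (auto intro!: divide_pos_pos divide_neg_pos)
  then have \<epsilon>: "0 < \<epsilon>" by (simp add: \<epsilon>_def)
  \<comment> \<open>The first bound in \<open>\<epsilon>\<close> keeps \<open>w\<close> future directed, the second makes the
    first-order decrease of \<open>f\<close> win over the second-order term.\<close>
  define w where "w = (1 + K * \<epsilon>\<^sup>2) *\<^sub>R v + \<epsilon> *\<^sub>R h"
  have "\<epsilon> * \<bar>co0 h\<bar> < co0 v"
  proof -
    have "\<epsilon> * (2 * (\<bar>co0 h\<bar> + 1)) \<le> co0 v"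
      by (rule iffD1[OF pos_le_divide_eq]) (auto simp: \<epsilon>_def add_nonneg_pos)
    moreover have "0 \<le> \<epsilon> * \<bar>co0 h\<bar>" using \<epsilon> by simp
    moreover have "\<epsilon> * (2 * (\<bar>co0 h\<bar> + 1)) = 2 * (\<epsilon> * \<bar>co0 h\<bar>) + 2 * \<epsilon>"
      by (simp add: algebra_simps)
    ultimately show ?thesis using \<epsilon> by linarith
  qed
  moreover have "- (\<epsilon> * co0 h) \<le> \<epsilon> * \<bar>co0 h\<bar>"
    using \<epsilon> mult_left_mono[of "- co0 h" "\<bar>co0 h\<bar>" \<epsilon>] by simp
  moreover have "0 \<le> K * \<epsilon>\<^sup>2 * co0 v" using K pos0 by simp
  ultimately have co: "0 < psp w e0"
    by (simp add: w_def psp_e0 coords_linear algebra_simps)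
  have "psp w w = (1 + K * \<epsilon>\<^sup>2)\<^sup>2 * psp v v + 2 * (1 + K * \<epsilon>\<^sup>2) * \<epsilon> * psp v h + \<epsilon>\<^sup>2 * psp h h"
    unfolding w_def psp_def coords_linear by algebra
  also have "\<dots> = 1 + (K * \<epsilon>\<^sup>2)\<^sup>2 + \<epsilon>\<^sup>2 * (K + (K + psp h h))"
    using v h by (simp add: power2_eq_square algebra_simps)
  also have "\<dots> \<ge> 1" using K by (simp add: K_def)
  finally have "w \<in> Uset"
    using co v h by (simp add: Uset_def w_def Herm_linear)
  then have "f v \<le> f w" by (rule min)
  also have "f w = (1 + K * \<epsilon>\<^sup>2) * f v + \<epsilon> * f h"
    using v h by (simp add: w_def gl_dual_linear[OF f] gl_linear Herm_subset_gl)
  finally have "\<epsilon> * (- f h) \<le> \<epsilon> * (\<epsilon> * (K * f v))" by (simp add: power2_eq_square algebra_simps)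
  then have "- f h \<le> \<epsilon> * (K * f v)" unfolding mult_le_cancel_left_pos[OF \<epsilon>] .
  also have "\<dots> \<le> \<epsilon> * A"
    unfolding A_def using \<epsilon> K by (intro mult_left_mono) (auto simp: mult_left_mono add_increasing2)
  also have "\<dots> \<le> - f h / 2"
  proof -
    have "\<epsilon> * (2 * A) \<le> - f h"
      by (rule iffD1[OF pos_le_divide_eq]) (use A in \<open>auto simp: \<epsilon>_def\<close>)
    then show ?thesis by simp
  qed
  finally show False using neg by simp
qed

text \<open>
  Lagrange multiplier rule: at a minimum point \<open>v\<close> the functional is a multiple of \<open>psp v\<close> on
  \<^term>\<open>Herm\<close>.  In particular it vanishes there if the minimum is \<open>0\<close>.
\<close>

lemma minimum_on_Uset_multiplier:
  assumes f: "f \<in> gl_dual" and v: "v \<in> Herm" "psp v v = 1" "0 < psp v e0"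
    and min: "\<And>w. w \<in> Uset \<Longrightarrow> f v \<le> f w" and h: "h \<in> Herm"
  shows "f h = f v * psp v h"
proof -
  define k where "k = h - psp v h *\<^sub>R v"
  have k: "k \<in> Herm" "psp v k = 0"
    using v h by (auto simp: k_def Herm_linear psp_diff_right psp_scaleR_right)
  have "0 \<le> f k" by (rule minimum_on_Uset_nonneg[OF f v min k])
  moreover have "0 \<le> f ((-1) *\<^sub>R k)"
    by (rule minimum_on_Uset_nonneg[OF f v min]) (use k in \<open>auto simp only: Herm_linear psp_scaleR_right\<close>)
  then have "f k \<le> 0" using k by (simp only: gl_dual_linear[OF f] Herm_subset_gl)
  ultimately have "f k = 0" by simp
  moreover have "f h = f k + psp v h * f v"
  proof -
    have "f (k + psp v h *\<^sub>R v) = f k + psp v h * f v"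
      using k v by (simp add: gl_dual_linear[OF f] gl_linear Herm_subset_gl)
    then show ?thesis by (simp add: k_def)
  qed
  ultimately show ?thesis by simp
qed

section \<open>The control of an abnormal extremal\<close>

lemma ac_covectorD:
  assumes "ac_covector J \<psi>" "{a..b} \<subseteq> J"
  shows "t \<in> {a..b} \<Longrightarrow> \<psi> t \<in> gl_dual" "w \<in> gl \<Longrightarrow> abs_continuous_on a b (\<lambda>t. \<psi> t w)"
  using assms by (auto simp: ac_covector_def)

lemma adjoint_equation_ae:
  assumes "adjoint_equation J u \<psi>" "{a..b} \<subseteq> J"
  shows "AE t in lebesgue. t \<in> {a..b} \<longrightarrow> (\<forall>w\<in>gl.
    ((\<lambda>s. \<psi> s w) has_real_derivative \<psi> t (lie_bracket (u t) w)) (at t within {a..b}))"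
  using assms(1)[unfolded adjoint_equation_def]
proof eventually_elim
  case (elim t)
  then show ?case using assms(2) by (auto intro: has_field_derivative_subset)
qed

lemma annihilator_constant:
  assumes ac: "ac_covector J \<psi>" and adj: "adjoint_equation J u \<psi>" and J: "{a..b} \<subseteq> J"
    and w: "w \<in> gl" and zero: "AE t in lebesgue. t \<in> {a..b} \<longrightarrow> \<psi> t (lie_bracket (u t) w) = 0"
    and t: "t \<in> {a..b}"
  shows "\<psi> t w = \<psi> a w"
proof (rule abs_continuous_zero_derivative_constant[OF ac_covectorD(2)[OF ac J w] _ t])
  show "AE t in lebesgue. t \<in> {a..b} \<longrightarrow> ((\<lambda>t. \<psi> t w) has_real_derivative 0) (at t within {a..b})"
    using adjoint_equation_ae[OF adj J] zero
  proof eventually_elim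
    case (elim t)
    then show ?case using w by fastforce
  qed
qed

lemma parallel_vectors:
  fixes q1 q2 q3 x1 x2 x3 :: real
  assumes q: "q1\<^sup>2 + q2\<^sup>2 + q3\<^sup>2 \<noteq> 0"
    and "x3 * q2 = x2 * q3" "x1 * q3 = x3 * q1" "x2 * q1 = x1 * q2"
  defines "k \<equiv> (x1 * q1 + x2 * q2 + x3 * q3) / (q1\<^sup>2 + q2\<^sup>2 + q3\<^sup>2)"
  shows "x1 = k * q1" "x2 = k * q2" "x3 = k * q3"
proof -
  have "x1 * (q1\<^sup>2 + q2\<^sup>2 + q3\<^sup>2) = (x1 * q1 + x2 * q2 + x3 * q3) * q1"
    "x2 * (q1\<^sup>2 + q2\<^sup>2 + q3\<^sup>2) = (x1 * q1 + x2 * q2 + x3 * q3) * q2"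
    "x3 * (q1\<^sup>2 + q2\<^sup>2 + q3\<^sup>2) = (x1 * q1 + x2 * q2 + x3 * q3) * q3"
    using assms(2-4) by algebra+
  then show "x1 = k * q1" "x2 = k * q2" "x3 = k * q3"
    using q by (simp_all add: k_def eq_divide_eq)
qed

text \<open>
  A covector function vanishing on \<^term>\<open>Herm\<close> is determined by its values \<open>q\<close> on
  \<^term>\<open>rot1\<close>, \<^term>\<open>rot2\<close>, \<^term>\<open>rot3\<close>.  These are constant, because brackets of the control with
  these matrices lie in \<^term>\<open>Herm\<close>.  Applied to Hermitian matrices the adjoint equation says that
  the cross product of \<open>q\<close> with the spatial part of the control vanishes.  So the spatial part stays
  on the line through the unit vector \<open>n\<close> in the direction of \<open>q\<close>.
\<close>

lemma abnormal_control_direction: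
  assumes ab: "a < b" and J: "{a..b} \<subseteq> J"
    and ac: "ac_covector J \<psi>" and nv: "nowhere_vanishing J \<psi>" and adj: "adjoint_equation J u \<psi>"
    and Herm: "AE t in lebesgue. t \<in> {a..b} \<longrightarrow> u t \<in> Herm"
    and zero: "\<And>t h. t \<in> {a..b} \<Longrightarrow> h \<in> Herm \<Longrightarrow> \<psi> t h = 0"
  obtains n where "n \<in> Wset"
    "AE t in lebesgue. t \<in> {a..b} \<longrightarrow> (\<exists>c. u t = co0 (u t) *\<^sub>R e0 + c *\<^sub>R n)"
proof -
  note dual = ac_covectorD(1)[OF ac J]
  have const: "\<psi> t w = \<psi> a w" if "t \<in> {a..b}" "w \<in> {rot1, rot2, rot3}" for t w
  proof (rule annihilator_constant[OF ac adj J _ _ that(1)])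
    show "w \<in> gl" using that rot_in_gl by auto
    show "AE t in lebesgue. t \<in> {a..b} \<longrightarrow> \<psi> t (lie_bracket (u t) w) = 0"
      using Herm by eventually_elim (use that zero lie_bracket_rot in auto)
  qed
  define q1 q2 q3 where "q1 = \<psi> a rot1" and "q2 = \<psi> a rot2" and "q3 = \<psi> a rot3"
  define Q where "Q = q1\<^sup>2 + q2\<^sup>2 + q3\<^sup>2"
  have "Q \<noteq> 0"
  proof
    assume "Q = 0"
    then have "q1 = 0" "q2 = 0" "q3 = 0"
      unfolding Q_def by (auto simp: add_nonneg_eq_0_iff)
    then have "\<psi> a w = 0" if "w \<in> gl" for w
      using gl_dual_eq_zero[OF dual[of a] zero[of a] _ _ _ that] ab
      by (simp add: q1_def q2_def q3_def)
    then show False using nv J ab unfolding nowhere_vanishing_def by fastforce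
  qed
  then have Q: "0 < Q" unfolding Q_def
    by (metis add_nonneg_nonneg less_eq_real_def zero_le_power2)
  define d where "d = sqrt Q"
  have d: "0 < d" "d\<^sup>2 = Q" using Q by (auto simp: d_def)
  define n where "n = (1 / d) *\<^sub>R (q1 *\<^sub>R e1 + q2 *\<^sub>R e2 + q3 *\<^sub>R e3)"
  have n_co: "co0 n = 0" "co1 n = q1 / d" "co2 n = q2 / d" "co3 n = q3 / d"
    by (simp_all add: n_def coords_linear coords_basis)
  have nH: "n \<in> Herm" by (simp add: n_def Herm_linear Herm_basis)
  have "(q1 / d)\<^sup>2 + (q2 / d)\<^sup>2 + (q3 / d)\<^sup>2 = Q / d\<^sup>2"
    unfolding Q_def power_divide add_divide_distrib by simp
  then have nn: "psp n n = -1"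
    using d Q by (simp add: psp_def n_co power2_eq_square)
  show thesis
  proof
    show "n \<in> Wset" using nH nn by (simp add: Wset_def psp_e0 n_co)
    show "AE t in lebesgue. t \<in> {a..b} \<longrightarrow> (\<exists>c. u t = co0 (u t) *\<^sub>R e0 + c *\<^sub>R n)"
      using Herm adjoint_equation_ae[OF adj J]
    proof eventually_elim
      case (elim t)
      show ?case
      proof
        assume t: "t \<in> {a..b}"
        let ?u = "u t"
        have uH: "?u \<in> Herm" using elim t by blast
        have br: "\<psi> t (lie_bracket ?u h) = 0" if "h \<in> Herm" for h
        proof -
          have "((\<lambda>s. \<psi> s h) has_real_derivative \<psi> t (lie_bracket ?u h)) (at t within {a..b})"
            using elim t Herm_subset_gl[OF that] by blast
          moreover have "((\<lambda>s. \<psi> s h) has_real_derivative 0) (at t within {a..b})"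
            by (rule has_field_derivative_transform_within[OF DERIV_const[of 0] zero_less_one t])
              (use zero that in auto)
          ultimately show ?thesis
            using vector_derivative_unique_within_closed_interval[OF ab t[folded box_real(2)]]
            by (metis box_real(2) has_real_derivative_iff_has_vector_derivative)
        qed
        have psi_rot: "\<psi> t (x *\<^sub>R v + y *\<^sub>R w) = x * \<psi> t v + y * \<psi> t w"
          if "v \<in> gl" "w \<in> gl" for x y v w
          using that by (simp add: gl_dual_linear[OF dual[OF t]] gl_linear)
        have q: "\<psi> t rot1 = q1" "\<psi> t rot2 = q2" "\<psi> t rot3 = q3"
          using const[OF t] by (simp_all add: q1_def q2_def q3_def)
        have "co3 ?u * q2 = co2 ?u * q3" "co1 ?u * q3 = co3 ?u * q1" "co2 ?u * q1 = co1 ?u * q2"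
          using br[OF Herm_basis(2)] br[OF Herm_basis(3)] br[OF Herm_basis(4)]
          unfolding lie_bracket_Herm[OF uH] psi_rot[OF rot_in_gl(2,3)] psi_rot[OF rot_in_gl(3,1)]
            psi_rot[OF rot_in_gl(1,2)] q by linarith+
        note par = parallel_vectors[OF \<open>Q \<noteq> 0\<close>[unfolded Q_def] this]
        define k where "k = (co1 ?u * q1 + co2 ?u * q2 + co3 ?u * q3) / (q1\<^sup>2 + q2\<^sup>2 + q3\<^sup>2)"
        have k: "co1 ?u = k * q1" "co2 ?u = k * q2" "co3 ?u = k * q3"
          using par unfolding k_def by blast+
        have "?u = co0 ?u *\<^sub>R e0 + (k * d) *\<^sub>R n"
          by (subst Herm_expand[OF uH]) (use d in \<open>simp add: k n_def scaleR_add_right\<close>)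
        then show "\<exists>c. ?u = co0 ?u *\<^sub>R e0 + c *\<^sub>R n" by blast
      qed
    qed
  qed
qed

lemma is_arg_min_le: "is_arg_min f P v \<Longrightarrow> P w \<Longrightarrow> f v \<le> (f w :: real)"
  by (auto simp: is_arg_min_def not_less)

lemma timelike_extremal_covector_on_Herm:
  assumes "timelike_extremal_wrt g u \<psi> M"
  shows "AE t in lebesgue. u t \<in> Herm \<and> psp (u t) (u t) = 1 \<and> 0 < psp (u t) e0 \<and>
    (\<forall>h\<in>Herm. \<psi> t h = M * psp (u t) h)"
proof -
  have dual: "\<psi> t \<in> gl_dual" for t
    using assms unfolding timelike_extremal_wrt_def ac_covector_def by blast
  have "AE t in lebesgue. t \<in> UNIV \<longrightarrow> u t \<in> Herm \<and> (g has_vector_derivative g t ** u t) (at t within UNIV)"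
    and "AE t in lebesgue. t \<in> UNIV \<longrightarrow> psp (u t) e0 > 0"
    and "AE t in lebesgue. psp (u t) (u t) = 1"
    and "AE t in lebesgue. is_arg_min (\<psi> t) (\<lambda>v. v \<in> Uset) (u t) \<and> \<psi> t (u t) = M"
    using assms unfolding timelike_extremal_wrt_def horizontal_curve_def future_directed_def
    by blast+
  then show ?thesis
  proof eventually_elim
    case (elim t)
    then have "\<psi> t h = M * psp (u t) h" if "h \<in> Herm" for h
      using minimum_on_Uset_multiplier[OF dual, of "u t" t h] is_arg_min_le[of "\<psi> t" "\<lambda>v. v \<in> Uset"] that
      by auto
    then show ?case using elim by simp
  qed
qed

section \<open>Nonstrictly abnormal extremals have constant control\<close>

lemma Wset_D:
  assumes "n \<in> Wset"
  shows "n \<in> Herm" "co0 n = 0" "psp n n = -1" "psp e0 n = 0" "psp n e0 = 0"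
  using assms psp_commute[of n e0] by (auto simp: Wset_def psp_e0)

lemma lie_bracket_self_combination:
  assumes "u = x *\<^sub>R e0 + y *\<^sub>R n"
  shows "lie_bracket u e0 = 0" "lie_bracket u n = 0"
  by (simp_all add: assms lie_bracket_def vec_eq_iff forall_2 matrix_matrix_mult_def sum_2 e0_def
      algebra_simps)

text \<open>
  The abnormal covector confines the control to the commutative plane spanned by \<^term>\<open>e0\<close> and
  \<open>n\<close>.  On this plane the normal covector is constant by the adjoint equation, and by the
  multiplier rule it is \<open>M\<close> times the scalar product with the control.
\<close>

lemma nonstrictly_abnormal_timelike_constant_control:
  assumes ab: "a < b" and ext: "nonstrictly_abnormal_timelike_extremal g u"
  obtains v where "v \<in> Herm" "psp v v = 1" "0 < psp v e0"
    "AE t in lebesgue. t \<in> {a..b} \<longrightarrow> u t = v"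
proof -
  obtain \<psi> where abn: "timelike_extremal_wrt g u \<psi> 0"
    using ext unfolding nonstrictly_abnormal_timelike_extremal_def abnormal_timelike_extremal_def by blast
  obtain \<phi> M where nor: "timelike_extremal_wrt g u \<phi> M" and M: "0 < M"
    using ext unfolding nonstrictly_abnormal_timelike_extremal_def normal_timelike_extremal_def by blast
  have ac: "ac_covector UNIV \<psi>" "nowhere_vanishing UNIV \<psi>" "adjoint_equation UNIV u \<psi>"
    and ac': "ac_covector UNIV \<phi>" "adjoint_equation UNIV u \<phi>"
    using abn nor unfolding timelike_extremal_wrt_def by blast+
  note ae = timelike_extremal_covector_on_Herm[OF abn]
  note ae' = timelike_extremal_covector_on_Herm[OF nor]
  have zero: "\<psi> t h = 0" if "t \<in> {a..b}" "h \<in> Herm" for t h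
  proof -
    have "\<psi> t h \<in> {0}"
    proof (rule continuous_closed_AE_imp_all[OF ab _ _ _ that(1)])
      show "continuous_on {a..b} (\<lambda>t. \<psi> t h)"
        using ac_covectorD(2)[OF ac(1)] Herm_subset_gl[OF that(2)]
        by (auto intro: abs_continuous_on_imp_continuous_on)
      show "AE t in lebesgue. t \<in> {a..b} \<longrightarrow> \<psi> t h \<in> {0}"
        using ae by eventually_elim (use that in auto)
    qed auto
    then show ?thesis by simp
  qed
  have "AE t in lebesgue. t \<in> {a..b} \<longrightarrow> u t \<in> Herm"
    using ae by eventually_elim auto
  from abnormal_control_direction[OF ab subset_UNIV ac this zero]
  obtain n where n: "n \<in> Wset"
    and dir: "AE t in lebesgue. t \<in> {a..b} \<longrightarrow> (\<exists>c. u t = co0 (u t) *\<^sub>R e0 + c *\<^sub>R n)"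
    by blast
  note nD = Wset_D[OF n]
  have const: "\<phi> t w = \<phi> a w" if "t \<in> {a..b}" "w \<in> {e0, n}" for t w
  proof (rule annihilator_constant[OF ac' subset_UNIV _ _ that(1)])
    show "w \<in> gl" using that Herm_basis nD by (auto intro: Herm_subset_gl)
    show "AE t in lebesgue. t \<in> {a..b} \<longrightarrow> \<phi> t (lie_bracket (u t) w) = 0"
      using dir
    proof eventually_elim
      case (elim t)
      then show ?case
        using lie_bracket_self_combination[of "u t"] that(2) gl_dual_zero[OF ac_covectorD(1)[OF ac'(1) subset_UNIV]]
        by fastforce
    qed
  qed
  define v where "v = (\<phi> a e0 / M) *\<^sub>R e0 + (- (\<phi> a n / M)) *\<^sub>R n"
  have uv: "AE t in lebesgue. t \<in> {a..b} \<longrightarrow>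
      u t = v \<and> u t \<in> Herm \<and> psp (u t) (u t) = 1 \<and> 0 < psp (u t) e0"
    using dir ae'
  proof eventually_elim
    case (elim t)
    show ?case
    proof
      assume t: "t \<in> {a..b}"
      then obtain c where c: "u t = co0 (u t) *\<^sub>R e0 + c *\<^sub>R n" using elim by blast
      have "psp (u t) n = - c"
        by (subst c) (simp add: psp_add_left psp_scaleR_left nD)
      then have "\<phi> a n = - (M * c)" using elim const[OF t, of n] nD(1) by simp
      moreover have "\<phi> a e0 = M * co0 (u t)"
        using elim const[OF t, of e0] Herm_basis(1) by (simp add: psp_e0)
      ultimately have "u t = v" using M by (subst c) (simp add: v_def)
      then show "u t = v \<and> u t \<in> Herm \<and> psp (u t) (u t) = 1 \<and> 0 < psp (u t) e0"
        using elim by blast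
    qed
  qed
  obtain t where "u t = v \<and> u t \<in> Herm \<and> psp (u t) (u t) = 1 \<and> 0 < psp (u t) e0"
    using AE_interval_obtain[OF ab uv] by blast
  moreover have "AE t in lebesgue. t \<in> {a..b} \<longrightarrow> u t = v"
    using uv by eventually_elim simp
  ultimately show thesis using that by metis
qed

lemma Wset_span_direction:
  assumes n: "n \<in> Wset" and w: "x *\<^sub>R e0 + y *\<^sub>R n \<in> Wset"
  shows "x = 0" "y = 1 \<or> y = -1"
proof -
  note nD = Wset_D[OF n] and wD = Wset_D[OF w]
  show x: "x = 0" using wD(2) by (simp add: coords_linear coords_basis nD)
  have "psp (x *\<^sub>R e0 + y *\<^sub>R n) (x *\<^sub>R e0 + y *\<^sub>R n) = - (y * y)"
    by (simp add: x psp_scaleR_left psp_scaleR_right nD)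
  then have "y\<^sup>2 = 1" using wD(3) by (simp add: power2_eq_square)
  then show "y = 1 \<or> y = -1" by (simp add: power2_eq_1_iff)
qed

text \<open>
  The abnormal covector leaves only the two normalized controls \<open>e0 + n\<close> and \<open>e0 - n\<close>.  The minimum
  condition expresses the sign by the value of the normal covector at \<open>n\<close>, which depends
  continuously on the parameter and takes the values \<open>1\<close> and \<open>-1\<close> only; hence it is constant.
\<close>

lemma nonstrictly_abnormal_isotropic_constant_control:
  assumes ab: "a < b" and J: "{a..b} \<subseteq> J"
    and ext: "nonstrictly_abnormal_isotropic_extremal J g u"
  obtains v where "v \<in> Herm" "psp v v = 0" "0 < psp v e0"
    "AE t in lebesgue. t \<in> {a..b} \<longrightarrow> u t = v"
proof -
  have curve: "isotropic_curve J g u"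
    using ext unfolding nonstrictly_abnormal_isotropic_extremal_def abnormal_isotropic_extremal_def by blast
  obtain \<psi> where abn: "ac_covector J \<psi>" "nowhere_vanishing J \<psi>" "adjoint_equation J u \<psi>"
    and zero: "\<And>t h. t \<in> J \<Longrightarrow> h \<in> Herm \<Longrightarrow> \<psi> t h = 0"
    using ext unfolding nonstrictly_abnormal_isotropic_extremal_def abnormal_isotropic_extremal_def by blast
  obtain c \<phi> where c: "0 < c"
    and nor: "normalized_isotropic_covector {t. c * t \<in> J} (\<lambda>t. c *\<^sub>R u (c * t)) \<phi>"
    using ext unfolding nonstrictly_abnormal_isotropic_extremal_def normal_isotropic_extremal_def by blast
  have acN: "ac_covector {t. c * t \<in> J} \<phi>" using nor by (simp add: normalized_isotropic_covector_def)
  have uH: "AE t in lebesgue. t \<in> {a..b} \<longrightarrow> u t \<in> Herm"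
    using curve J unfolding isotropic_curve_def horizontal_curve_def
    by (auto elim!: eventually_mono)
  obtain n where n: "n \<in> Wset"
    and dir: "AE t in lebesgue. t \<in> {a..b} \<longrightarrow> (\<exists>d. u t = co0 (u t) *\<^sub>R e0 + d *\<^sub>R n)"
    using abnormal_control_direction[OF ab J abn uH] zero J by blast
  note nD = Wset_D[OF n]
  have J': "{a / c..b / c} \<subseteq> {t. c * t \<in> J}"
    using J c by (auto simp: field_simps)
  have ab': "a / c < b / c" using ab c by (simp add: divide_strict_right_mono)
  \<comment> \<open>The normal covector lives on the rescaled parameter interval; the division by \<open>c\<close> pulls
    it back to \<open>{a..b}\<close>.\<close>
  define \<theta> where "\<theta> t = \<phi> (t / c) n" for t
  have cont: "continuous_on {a..b} \<theta>"
  proof -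
    have "continuous_on {a / c..b / c} (\<lambda>t. \<phi> t n)"
      by (rule abs_continuous_on_imp_continuous_on[OF
            ac_covectorD(2)[OF acN J' Herm_subset_gl[OF nD(1)]]])
    then show ?thesis unfolding \<theta>_def
      by (rule continuous_on_compose2) (use c in \<open>auto intro!: continuous_intros divide_right_mono\<close>)
  qed
  have "AE t in lebesgue. c * t \<in> J \<longrightarrow>
      is_arg_min (\<phi> t) (\<lambda>w. w \<in> Wset) (c *\<^sub>R u (c * t) - e0) \<and> \<phi> t (c *\<^sub>R u (c * t) - e0) = -1"
    using nor by (simp add: normalized_isotropic_covector_def)
  from AE_lebesgue_scale[OF _ this, of c]
  have "AE t in lebesgue. t \<in> J \<longrightarrow>
      is_arg_min (\<phi> (t / c)) (\<lambda>w. w \<in> Wset) (c *\<^sub>R u t - e0) \<and> \<phi> (t / c) (c *\<^sub>R u t - e0) = -1"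
    using c by simp
  with dir have sign: "AE t in lebesgue. t \<in> {a..b} \<longrightarrow>
      \<theta> t \<in> {1, -1} \<and> c *\<^sub>R u t = e0 - \<theta> t *\<^sub>R n"
  proof eventually_elim
    case (elim t)
    show ?case
    proof
      assume t: "t \<in> {a..b}"
      then obtain d where d: "u t = co0 (u t) *\<^sub>R e0 + d *\<^sub>R n" using elim by blast
      have W: "c *\<^sub>R u t - e0 \<in> Wset" and m: "\<phi> (t / c) (c *\<^sub>R u t - e0) = -1"
        using elim t J by (auto simp: is_arg_min_def)
      have eq: "c *\<^sub>R u t - e0 = (c * co0 (u t) - 1) *\<^sub>R e0 + (c * d) *\<^sub>R n"
        by (subst d) (simp add: algebra_simps)
      have x: "c * co0 (u t) - 1 = 0" and y: "c * d = 1 \<or> c * d = -1"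
        using Wset_span_direction[OF n W[unfolded eq]] by blast+
      have w: "c *\<^sub>R u t - e0 = (c * d) *\<^sub>R n" using eq x by simp
      have "t / c \<in> {a / c..b / c}" using t c by (auto simp: divide_right_mono)
      then have "\<phi> (t / c) \<in> gl_dual" by (rule ac_covectorD(1)[OF acN J'])
      then have "(c * d) * \<theta> t = -1"
        using m Herm_subset_gl[OF nD(1)] unfolding w by (simp add: gl_dual_linear \<theta>_def)
      then have "\<theta> t = - (c * d)" "\<theta> t \<in> {1, -1}" using y by auto
      then show "\<theta> t \<in> {1, -1} \<and> c *\<^sub>R u t = e0 - \<theta> t *\<^sub>R n"
        using w by (simp add: algebra_simps)
    qed
  qed
  have all: "\<theta> t \<in> {1, -1}" if "t \<in> {a..b}" for t
  proof (rule continuous_closed_AE_imp_all[OF ab cont _ _ that])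
    show "AE t in lebesgue. t \<in> {a..b} \<longrightarrow> \<theta> t \<in> {1, -1}"
      using sign by eventually_elim simp
  qed simp
  have "\<theta> constant_on {a..b}"
  proof (rule continuous_finite_range_constant[OF _ cont])
    have "\<theta> ` {a..b} \<subseteq> {1, -1}" using all by blast
    then show "finite (\<theta> ` {a..b})" by (rule finite_subset) simp
  qed simp
  then obtain \<kappa> where \<kappa>: "\<And>t. t \<in> {a..b} \<Longrightarrow> \<theta> t = \<kappa>" unfolding constant_on_def by blast
  have \<kappa>2: "\<kappa> * \<kappa> = 1" using all[of a] \<kappa>[of a] ab by auto
  define v where "v = (1 / c) *\<^sub>R (e0 - \<kappa> *\<^sub>R n)"
  show thesis
  proof
    show "v \<in> Herm" by (simp add: v_def Herm_linear Herm_basis nD)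
    have co0v: "co0 v = 1 / c" by (simp add: v_def coords_linear coords_basis nD)
    then show "0 < psp v e0" using c by (simp add: psp_e0)
    have "psp (e0 - \<kappa> *\<^sub>R n) (e0 - \<kappa> *\<^sub>R n) = psp e0 e0 - 2 * \<kappa> * psp e0 n + \<kappa> * \<kappa> * psp n n"
      unfolding psp_def coords_linear by algebra
    then have "psp (e0 - \<kappa> *\<^sub>R n) (e0 - \<kappa> *\<^sub>R n) = 0"
      by (simp add: nD \<kappa>2 psp_e0 coords_basis)
    then show "psp v v = 0" by (simp add: v_def psp_scaleR_left psp_scaleR_right)
    show "AE t in lebesgue. t \<in> {a..b} \<longrightarrow> u t = v"
      using sign
    proof eventually_elim
      case (elim t)
      show ?case
      proof
        assume t: "t \<in> {a..b}"
        have "u t = (1 / c) *\<^sub>R (c *\<^sub>R u t)" using c by simp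
        also have "\<dots> = v" using elim t \<kappa>[OF t] by (simp add: v_def)
        finally show "u t = v" .
      qed
    qed
  qed
qed

section \<open>Nonstrictly abnormal extremals are longest arcs\<close>

lemma horizontal_curve_subset:
  assumes "horizontal_curve J g u" "I \<subseteq> J"
  shows "horizontal_curve I g u"
  unfolding horizontal_curve_def
proof (intro conjI allI impI)
  show "g ` I \<subseteq> GLplus" "\<And>a b. {a..b} \<subseteq> I \<Longrightarrow> \<exists>L. L-lipschitz_on {a..b} g"
    using assms unfolding horizontal_curve_def by blast+
  have "AE t in lebesgue. t \<in> J \<longrightarrow> u t \<in> Herm \<and> (g has_vector_derivative g t ** u t) (at t within J)"
    using assms(1) unfolding horizontal_curve_def by blast
  then show "AE t in lebesgue. t \<in> I \<longrightarrow> u t \<in> Herm \<and> (g has_vector_derivative g t ** u t) (at t within I)"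
    by eventually_elim (use assms(2) in \<open>auto intro: has_vector_derivative_within_subset\<close>)
qed

theorem corollary5:
  fixes g u :: "real \<Rightarrow> cmat2" and J :: "real set" and a b :: real
  assumes "a < b"
  shows "(nonstrictly_abnormal_timelike_extremal g u \<longrightarrow>
            longest_arc a b g u \<and> proportional_to_arclength a b u) \<and>
         (is_interval J \<and> {a..b} \<subseteq> J \<and> nonstrictly_abnormal_isotropic_extremal J g u \<longrightarrow>
            longest_arc a b g u)"
proof (intro conjI impI)
  assume ext: "nonstrictly_abnormal_timelike_extremal g u"
  obtain v where v: "v \<in> Herm" "psp v v = 1" "0 < psp v e0"
    and uv: "AE t in lebesgue. t \<in> {a..b} \<longrightarrow> u t = v"
    using nonstrictly_abnormal_timelike_constant_control[OF assms ext] .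
  have curve: "horizontal_curve UNIV g u" "future_directed UNIV u"
    and speed: "AE t in lebesgue. psp (u t) (u t) = 1"
    using ext unfolding nonstrictly_abnormal_timelike_extremal_def normal_timelike_extremal_def
      timelike_extremal_wrt_def by blast+
  have "causal_curve {a..b} g u"
    using curve speed horizontal_curve_subset[OF curve(1) subset_UNIV]
    unfolding causal_curve_def nonspacelike_def future_directed_def by (auto elim: eventually_mono)
  then show "longest_arc a b g u"
    using constant_control_longest_arc[OF assms _ uv] v by simp
  show "proportional_to_arclength a b u"
    unfolding proportional_to_arclength_def
  proof (intro exI[of _ 1] conjI allI impI)
    fix s t assume st: "a \<le> s \<and> s \<le> t \<and> t \<le> b"
    have "AE x in lebesgue. x \<in> {s..t} \<longrightarrow> psp (u x) (u x) = 1"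
      using speed by eventually_elim simp
    then show "curve_length s t u = 1 * (t - s)"
      using curve_length_constant_speed[of s t u 1] st by simp
  qed simp
next
  assume "is_interval J \<and> {a..b} \<subseteq> J \<and> nonstrictly_abnormal_isotropic_extremal J g u"
  then have J: "{a..b} \<subseteq> J" and ext: "nonstrictly_abnormal_isotropic_extremal J g u" by auto
  obtain v where v: "v \<in> Herm" "psp v v = 0" "0 < psp v e0"
    and uv: "AE t in lebesgue. t \<in> {a..b} \<longrightarrow> u t = v"
    using nonstrictly_abnormal_isotropic_constant_control[OF assms J ext] .
  have "horizontal_curve J g u"
    using ext unfolding nonstrictly_abnormal_isotropic_extremal_def abnormal_isotropic_extremal_def
      isotropic_curve_def by blast
  then have "causal_curve {a..b} g u"
    using horizontal_curve_subset[OF _ J] uv v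
    unfolding causal_curve_def nonspacelike_def future_directed_def by (auto elim: eventually_mono)
  then show "longest_arc a b g u"
    using constant_control_longest_arc[OF assms _ uv] v by simp
qed

end
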